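(* Let $\Bbbk$ be a field of characteristic $0$, let $C$ be an affine curve over $\Bbbk$ (possibly singular), and let $\mathcal{L} = \mathcal{L}(C)$ be the Krichever-Novikov algebra on $C$. Then the universal enveloping algebra $U(\mathcal{L})$ is not noetherian.
   Context: An affine curve $C$ is taken to be irreducible and reduced, so its coordinate ring $\Bbbk[C]$ is a finitely generated commutative $\Bbbk$-algebra that is an integral domain of Krull dimension $1$. For a commutative $\Bbbk$-algebra $A$, $\operatorname{Der}(A)$ denotes the Lie algebra of $\Bbbk$-linear maps $v : A \to A$ with $v(ab) = a v(b) + v(a) b$ for all $a,b \in A$, with the commutator as Lie bracket. The Krichever-Novikov algebra on $C$ is $\mathcal{L}(C) = \operatorname{Der}(\Bbbk[C])$, the Lie algebra of vector fields on $C$. Noetherian means left and right noetherian (equivalent to each other for universal enveloping algebras). *)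

theory Defs
  imports
    "HOL-Algebra.Algebra"
    "HOL-Algebra.Algebraic_Closure_Type"
    "HOL-Library.Poly_Mapping"
    "HOL-Library.Function_Algebras"
    "HOL-Library.Extended_Nat"
begin

section \<open>Affine curves\<close>

locale k_algebra = vector_space scale
  for scale :: "'k::field \<Rightarrow> 'a::comm_ring_1 \<Rightarrow> 'a" +
  assumes scale_mult_left: "scale c (a * b) = scale c a * b"
begin

lemma scale_mult_right: "scale c (a * b) = a * scale c b"
  by (metis mult.commute scale_mult_left)

definition subalgebra :: "'a set \<Rightarrow> bool" where
  "subalgebra B \<longleftrightarrow> subspace B \<and> 1 \<in> B \<and> (\<forall>a\<in>B. \<forall>b\<in>B. a * b \<in> B)"

definition finitely_generated_algebra :: bool where
  "finitely_generated_algebra \<longleftrightarrow> (\<exists>S. finite S \<and> subalgebra hull S = UNIV)"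

end

text \<open>The supremum of the lengths \<open>n\<close> of the chains
  \<open>P 0 \<subset> P 1 \<subset> \<dots> \<subset> P n\<close> of prime ideals (so the zero ring gets the value \<open>0\<close>).\<close>

definition krull_dim :: "('a, 'b) ring_scheme \<Rightarrow> enat" where
  "krull_dim R = Sup {enat n | n. \<exists>P. (\<forall>i\<le>n. primeideal (P i) R) \<and> (\<forall>i<n. P i \<subset> P (Suc i))}"

text \<open>An irreducible and reduced affine curve is given by its coordinate ring, here the type \<open>'a\<close>.
  It may be singular, and the field \<open>'k\<close> need not be algebraically closed.\<close>

locale affine_curve = k_algebra scale
  for scale :: "'k::field \<Rightarrow> 'a::idom \<Rightarrow> 'a" +
  assumes finitely_generated: finitely_generated_algebra
    and krull_dim_1: "krull_dim (ring_of_type_algebra :: 'a ring) = 1"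


section \<open>Lie algebras\<close>

text \<open>A Lie algebra is carried by a subspace \<open>vectors\<close> of a vector space type, with the addition
  of that type.\<close>

record ('k, 'v) lie_alg =
  vectors :: "'v set"
  smul :: "'k \<Rightarrow> 'v \<Rightarrow> 'v"
  bracket :: "'v \<Rightarrow> 'v \<Rightarrow> 'v"

locale lie_algebra = vector_space "smul \<LL>"
  for \<LL> :: "('k::field, 'v::ab_group_add) lie_alg" +
  assumes subspace_vectors: "subspace (vectors \<LL>)"
    and bracket_closed: "\<lbrakk>x \<in> vectors \<LL>; y \<in> vectors \<LL>\<rbrakk> \<Longrightarrow> bracket \<LL> x y \<in> vectors \<LL>"
    and bracket_add_left: "\<lbrakk>x \<in> vectors \<LL>; y \<in> vectors \<LL>; z \<in> vectors \<LL>\<rbrakk> \<Longrightarrow>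
      bracket \<LL> (x + y) z = bracket \<LL> x z + bracket \<LL> y z"
    and bracket_add_right: "\<lbrakk>x \<in> vectors \<LL>; y \<in> vectors \<LL>; z \<in> vectors \<LL>\<rbrakk> \<Longrightarrow>
      bracket \<LL> x (y + z) = bracket \<LL> x y + bracket \<LL> x z"
    and bracket_smul_left: "\<lbrakk>x \<in> vectors \<LL>; y \<in> vectors \<LL>\<rbrakk> \<Longrightarrow>
      bracket \<LL> (smul \<LL> c x) y = smul \<LL> c (bracket \<LL> x y)"
    and bracket_smul_right: "\<lbrakk>x \<in> vectors \<LL>; y \<in> vectors \<LL>\<rbrakk> \<Longrightarrow>
      bracket \<LL> x (smul \<LL> c y) = smul \<LL> c (bracket \<LL> x y)"
    and bracket_self: "x \<in> vectors \<LL> \<Longrightarrow> bracket \<LL> x x = 0"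
    and jacobi: "\<lbrakk>x \<in> vectors \<LL>; y \<in> vectors \<LL>; z \<in> vectors \<LL>\<rbrakk> \<Longrightarrow>
      bracket \<LL> x (bracket \<LL> y z) + bracket \<LL> y (bracket \<LL> z x) + bracket \<LL> z (bracket \<LL> x y) = 0"

definition derivations :: "('k::field \<Rightarrow> 'a::comm_ring_1 \<Rightarrow> 'a) \<Rightarrow> ('a \<Rightarrow> 'a) set" where
  "derivations scale =
     {v. Vector_Spaces.linear scale scale v \<and> (\<forall>a b. v (a * b) = a * v b + v a * b)}"

definition Der :: "('k::field \<Rightarrow> 'a::comm_ring_1 \<Rightarrow> 'a) \<Rightarrow> ('k, 'a \<Rightarrow> 'a) lie_alg" where
  "Der scale =
     \<lparr>vectors = derivations scale,
      smul = (\<lambda>c v a. scale c (v a)),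
      bracket = (\<lambda>v w a. v (w a) - w (v a))\<rparr>"

abbreviation krichever_novikov :: "('k::field \<Rightarrow> 'a::idom \<Rightarrow> 'a) \<Rightarrow> ('k, 'a \<Rightarrow> 'a) lie_alg" where
  "krichever_novikov scale \<equiv> Der scale"

lemma (in k_algebra) linear_iff_pointwise:
  "Vector_Spaces.linear scale scale v \<longleftrightarrow>
     (\<forall>a b. v (a + b) = v a + v b) \<and> (\<forall>c a. v (scale c a) = scale c (v a))"
proof -
  have "vector_space scale" by (rule vector_space_axioms)
  then show ?thesis
    by (auto simp: Vector_Spaces.linear_def module_hom_def module_hom_axioms_def module_axioms)
qed

lemma (in k_algebra) lie_algebra_Der: "lie_algebra (Der scale)"
proof -
  have vs: "vector_space (smul (Der scale))"
    by unfold_locales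
      (auto simp: Der_def fun_eq_iff plus_fun_def scale_right_distrib scale_left_distrib)
  have lin: "v \<in> derivations scale \<longleftrightarrow>
     (\<forall>a b. v (a + b) = v a + v b) \<and> (\<forall>c a. v (scale c a) = scale c (v a)) \<and>
     (\<forall>a b. v (a * b) = a * v b + v a * b)" for v
    by (auto simp: derivations_def linear_iff_pointwise)
  have diff: "v (a - b) = v a - v b" if "v \<in> derivations scale" for v a b
    using that unfolding lin by (metis add_diff_cancel diff_add_cancel)
  interpret D: vector_space "smul (Der scale)" by (rule vs)
  show ?thesis
  proof unfold_locales
    have z: "v 0 = 0" if "v \<in> derivations scale" for v
      using diff[OF that, of 0 0] by simp
    have "(\<lambda>a. scale c (v a)) \<in> derivations scale" if "v \<in> derivations scale" for c v
      using that by (simp add: lin scale_right_distrib scale_left_commute scale_mult_left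
          flip: scale_mult_right)
    moreover have "v + w \<in> derivations scale"
      if "v \<in> derivations scale" "w \<in> derivations scale" for v w
      using that by (simp add: lin scale_right_distrib algebra_simps)
    moreover have "0 \<in> derivations scale"
      by (simp add: lin)
    ultimately show "D.subspace (vectors (Der scale))"
      unfolding D.subspace_def by (simp add: Der_def)
  qed (auto simp: Der_def lin diff[unfolded lin] fun_eq_iff plus_fun_def zero_fun_def algebra_simps
         scale_right_diff_distrib)
qed


section \<open>Universal enveloping algebras\<close>

text \<open>Words over an alphabet form the free monoid, written additively because \<open>'m \<Rightarrow>\<^sub>0 'k\<close> is the
  monoid algebra of an additively written monoid. So \<open>'v fword \<Rightarrow>\<^sub>0 'k\<close> is the free associative
  unital algebra on \<open>'v\<close>.\<close>

datatype 'v fword = FWord (letters: "'v list")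

instantiation fword :: (type) monoid_add
begin

definition zero_fword_def: "0 = FWord []"
definition plus_fword_def: "u + w = FWord (letters u @ letters w)"

instance
  by standard (auto simp: zero_fword_def plus_fword_def)

end

definition free_algebra :: "'v set \<Rightarrow> ('v fword \<Rightarrow>\<^sub>0 'k::field) ring" where
  "free_algebra V =
     \<lparr>carrier = {f. \<forall>w\<in>Poly_Mapping.keys f. set (letters w) \<subseteq> V}, monoid.mult = (*), monoid.one = 1,
      ring.zero = 0, ring.add = (+)\<rparr>"

text \<open>\<open>monomial c xs\<close> is the scalar \<open>c\<close> times the product of the generators listed in \<open>xs\<close>.\<close>

abbreviation monomial :: "'k::field \<Rightarrow> 'v list \<Rightarrow> ('v fword \<Rightarrow>\<^sub>0 'k)" where
  "monomial c xs \<equiv> Poly_Mapping.single (FWord xs) c"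

text \<open>The first two sets of relations turn the free algebra on the set \<open>vectors \<LL>\<close> into the tensor
  algebra of the vector space \<open>vectors \<LL>\<close>; the third consists of the relations
  \<open>x \<otimes> y - y \<otimes> x - [x, y]\<close>.\<close>

definition enveloping_relations ::
    "('k::field, 'v::ab_group_add) lie_alg \<Rightarrow> ('v fword \<Rightarrow>\<^sub>0 'k) set" where
  "enveloping_relations \<LL> =
     {monomial 1 [x + y] - monomial 1 [x] - monomial 1 [y] | x y.
        x \<in> vectors \<LL> \<and> y \<in> vectors \<LL>} \<union>
     {monomial 1 [smul \<LL> c x] - monomial c [x] | c x. x \<in> vectors \<LL>} \<union>
     {monomial 1 [x, y] - monomial 1 [y, x] - monomial 1 [bracket \<LL> x y] | x y.
        x \<in> vectors \<LL> \<and> y \<in> vectors \<LL>}"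

text \<open>In HOL-Algebra ideals are two-sided, so \<open>Idl\<close> is the generated two-sided ideal.\<close>

definition universal_enveloping_algebra ::
    "('k::field, 'v::ab_group_add) lie_alg \<Rightarrow> ('v fword \<Rightarrow>\<^sub>0 'k) set ring" where
  "universal_enveloping_algebra \<LL> =
     free_algebra (vectors \<LL>) Quot (Idl\<^bsub>free_algebra (vectors \<LL>)\<^esub> enveloping_relations \<LL>)"

lemma ring_free_algebra: "ring (free_algebra V :: ('v fword \<Rightarrow>\<^sub>0 'k::field) ring)"
proof -
  let ?C = "{f :: 'v fword \<Rightarrow>\<^sub>0 'k. \<forall>w\<in>Poly_Mapping.keys f. set (letters w) \<subseteq> V}"
  have add: "f + g \<in> ?C" if "f \<in> ?C" "g \<in> ?C" for f g
    using that Poly_Mapping.keys_add[of f g] by blast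
  have mult: "f * g \<in> ?C" if fg: "f \<in> ?C" "g \<in> ?C" for f g
  proof -
    have "set (letters w) \<subseteq> V" if w: "w \<in> Poly_Mapping.keys (f * g)" for w
    proof -
      obtain u v where "w = u + v" "u \<in> Poly_Mapping.keys f" "v \<in> Poly_Mapping.keys g"
        using w Poly_Mapping.keys_mult[of f g] by blast
      then show ?thesis using fg by (auto simp: plus_fword_def)
    qed
    then show ?thesis by blast
  qed
  have one: "1 \<in> ?C"
    by (auto simp: zero_fword_def simp flip: single_one split: if_splits)
  have um: "- f \<in> ?C" if "f \<in> ?C" for f
    using that by simp
  have simps: "carrier (free_algebra V) = ?C"
    "monoid.mult (free_algebra V) = ((*) :: _ \<Rightarrow> _ \<Rightarrow> 'v fword \<Rightarrow>\<^sub>0 'k)"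
    "\<one>\<^bsub>free_algebra V\<^esub> = (1 :: 'v fword \<Rightarrow>\<^sub>0 'k)"
    "\<zero>\<^bsub>free_algebra V\<^esub> = (0 :: 'v fword \<Rightarrow>\<^sub>0 'k)"
    "ring.add (free_algebra V) = ((+) :: _ \<Rightarrow> _ \<Rightarrow> 'v fword \<Rightarrow>\<^sub>0 'k)"
    by (simp_all add: free_algebra_def)
  have zero: "0 \<in> ?C"
    by simp
  show ?thesis
  proof (rule ringI)
    show "abelian_group (free_algebra V :: ('v fword \<Rightarrow>\<^sub>0 'k) ring)"
      by (rule abelian_groupI, unfold simps)
        (fact add, fact zero, rule add.assoc, rule add.commute, rule add_0,
          rule bexI, rule left_minus, erule um)
    show "Group.monoid (free_algebra V :: ('v fword \<Rightarrow>\<^sub>0 'k) ring)"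
      by (rule monoidI, unfold simps) (fact mult, fact one, rule mult.assoc, simp_all)
  qed (unfold simps, rule distrib_right, rule distrib_left)
qed

lemma (in lie_algebra) enveloping_relations_carrier:
  "enveloping_relations \<LL> \<subseteq> carrier (free_algebra (vectors \<LL>))"
proof -
  have mon: "monomial c xs \<in> carrier (free_algebra (vectors \<LL>))" if "set xs \<subseteq> vectors \<LL>" for c xs
    using that by (auto simp: free_algebra_def split: if_splits)
  have diff: "f - g \<in> carrier (free_algebra (vectors \<LL>))"
    if "f \<in> carrier (free_algebra (vectors \<LL>))" "g \<in> carrier (free_algebra (vectors \<LL>))"
    for f g :: "'v fword \<Rightarrow>\<^sub>0 'k"
    using that Poly_Mapping.keys_diff[of f g] by (auto simp: free_algebra_def)
  show ?thesis
    unfolding enveloping_relations_def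
    by (auto intro!: diff mon
        simp: subspace_add[OF subspace_vectors] subspace_scale[OF subspace_vectors] bracket_closed)
qed

lemma (in lie_algebra) ring_universal_enveloping_algebra:
  "ring (universal_enveloping_algebra \<LL>)"
  unfolding universal_enveloping_algebra_def
  by (intro ideal.quotient_is_ring ring.genideal_ideal ring_free_algebra
      enveloping_relations_carrier)


section \<open>Noetherian rings\<close>

text \<open>The predicate \<^locale>\<open>noetherian_ring\<close> of HOL-Algebra only concerns two-sided ideals, which is
  not the right condition for noncommutative rings.\<close>

definition left_ideal :: "'a set \<Rightarrow> ('a, 'b) ring_scheme \<Rightarrow> bool" where
  "left_ideal I R \<longleftrightarrow> additive_subgroup I R \<and> (\<forall>a\<in>I. \<forall>r\<in>carrier R. r \<otimes>\<^bsub>R\<^esub> a \<in> I)"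

definition right_ideal :: "'a set \<Rightarrow> ('a, 'b) ring_scheme \<Rightarrow> bool" where
  "right_ideal I R \<longleftrightarrow> additive_subgroup I R \<and> (\<forall>a\<in>I. \<forall>r\<in>carrier R. a \<otimes>\<^bsub>R\<^esub> r \<in> I)"

definition left_noetherian :: "('a, 'b) ring_scheme \<Rightarrow> bool" where
  "left_noetherian R \<longleftrightarrow>
     (\<forall>I. left_ideal I R \<longrightarrow>
        (\<exists>S\<subseteq>carrier R. finite S \<and> I = (\<lambda>J. left_ideal J R) hull S))"

definition right_noetherian :: "('a, 'b) ring_scheme \<Rightarrow> bool" where
  "right_noetherian R \<longleftrightarrow>
     (\<forall>I. right_ideal I R \<longrightarrow>
        (\<exists>S\<subseteq>carrier R. finite S \<and> I = (\<lambda>J. right_ideal J R) hull S))"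

definition noetherian :: "('a, 'b) ring_scheme \<Rightarrow> bool" where
  "noetherian R \<longleftrightarrow> left_noetherian R \<and> right_noetherian R"

end

theory Submission
  imports Defs "HOL-Computational_Algebra.Polynomial_Factorial" "HOL-Library.Product_Plus"
begin

text \<open>
  Let \<open>A\<close> be the coordinate ring, \<open>K\<close> its field of fractions and \<open>L = Der(A)\<close>. The obstruction to being
  noetherian comes from a single 1-cocycle, the divergence \<open>div : L \<rightarrow> K\<close>, where \<open>L\<close> acts on \<open>K\<close> by
  derivations. It extends \<open>K\<close> to a module \<open>M = k \<oplus> K\<close> with \<open>v (c, b) = (0, v b + c div v)\<close>.

  Put \<open>m = (1, 0)\<close> and let \<open>Q\<close> be the annihilator of \<open>K\<close> in \<open>U(L)\<close>. Since \<open>v m\<close> lies in \<open>K\<close> for all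
  \<open>v\<close> in \<open>L\<close>, the map \<open>u \<mapsto> u m\<close> kills \<open>Q L\<close>. So if \<open>Q\<close> is generated as a right ideal by finitely
  many elements \<open>q\<close>, then \<open>Q m\<close> is spanned by the vectors \<open>q m\<close> and has finite dimension
  (\<open>annihilator_orbit_finite_dim\<close>). On the other hand, for \<open>v\<close> in \<open>L\<close> and \<open>h, w\<close> in \<open>A\<close> the element
  \<open>(h w\<^sup>2 v) v - 2 (h w v) (w v) + (h v) (w\<^sup>2 v)\<close> of \<open>U(L)\<close> lies in \<open>Q\<close> and maps \<open>m\<close> to
  \<open>(0, 2 h v(w)\<^sup>2)\<close> (\<open>annihilator_element\<close>). Indeed, its terms \<open>(f v) (g v)\<close> are chosen such that the
  sums of the \<open>f g\<close> and of the \<open>f v(g)\<close> vanish, which makes it act by zero on \<open>K\<close>; but the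
  divergence of \<open>g v\<close> involves \<open>v(g)\<close>, and so the sum of the \<open>f v(v(g))\<close> shows in the image of \<open>m\<close>.
  If \<open>v(w) \<noteq> 0\<close>, letting \<open>h\<close> run through the powers of a transcendental element makes \<open>Q m\<close>
  infinite-dimensional.

  It remains to find \<open>v\<close>, \<open>w\<close> and the divergence. As \<open>A\<close> has Krull dimension 1 it is not a field.
  Nonzero algebraic elements of a domain over \<open>k\<close> are units, so \<open>A\<close> contains an element \<open>w\<close> that
  is transcendental over \<open>k\<close>. Adjoining \<open>w\<close> and then the
  generators of \<open>A\<close> to \<open>k\<close>, one at a time, gives a finite set \<open>T\<close> containing \<open>w\<close>, such that a
  \<open>k\<close>-derivation of \<open>K\<close> is the same as a function \<open>T \<rightarrow> K\<close>: a transcendental element may be sent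
  anywhere, and in characteristic 0 the value of a derivation at an algebraic element is determined
  by the derivative of its minimal polynomial. The dual derivations \<open>d\<^sub>t\<close> give
  \<open>div v = (\<Sum>t\<in>T. d\<^sub>t (v t))\<close>, and clearing denominators in \<open>d\<^sub>w\<close> gives a derivation \<open>v\<close> of \<open>A\<close> with
  \<open>v(w) \<noteq> 0\<close>. Every derivation of \<open>A\<close> extends to \<open>K\<close>, so the singularities of the curve do no harm.
\<close>

section \<open>Derivations on subrings\<close>

definition unital_subring :: "'f::idom set \<Rightarrow> bool" where
  "unital_subring S \<longleftrightarrow> 1 \<in> S \<and> (\<forall>a\<in>S. \<forall>b\<in>S. a - b \<in> S \<and> a * b \<in> S)"

lemma unital_subringD:
  assumes "unital_subring S"
  shows "0 \<in> S" "1 \<in> S"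
    and "a \<in> S \<Longrightarrow> b \<in> S \<Longrightarrow> a - b \<in> S" "a \<in> S \<Longrightarrow> b \<in> S \<Longrightarrow> a * b \<in> S"
    and "a \<in> S \<Longrightarrow> - a \<in> S" "a \<in> S \<Longrightarrow> b \<in> S \<Longrightarrow> a + b \<in> S" "of_nat n \<in> S"
proof -
  show zero: "0 \<in> S"
    using assms unfolding unital_subring_def by (metis diff_self)
  show one: "1 \<in> S"
    and diff: "a \<in> S \<Longrightarrow> b \<in> S \<Longrightarrow> a - b \<in> S" and "a \<in> S \<Longrightarrow> b \<in> S \<Longrightarrow> a * b \<in> S" for a b
    using assms unfolding unital_subring_def by blast+
  show minus: "a \<in> S \<Longrightarrow> - a \<in> S" for a
    using diff[OF zero, of a] by simp
  show plus: "a \<in> S \<Longrightarrow> b \<in> S \<Longrightarrow> a + b \<in> S" for a b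
    using diff[OF _ minus, of a b] by simp
  show "of_nat n \<in> S"
    by (induction n) (auto intro: zero one plus)
qed

definition polys_over :: "'f::idom set \<Rightarrow> 'f poly set" where
  "polys_over S = {q. \<forall>i. poly.coeff q i \<in> S}"

lemma polys_over_pCons [simp]: "pCons a q \<in> polys_over S \<longleftrightarrow> a \<in> S \<and> q \<in> polys_over S"
  by (auto simp: polys_over_def coeff_pCons split: nat.splits)

lemma polys_over_closed:
  assumes "unital_subring S"
  shows "0 \<in> polys_over S"
    and "p \<in> polys_over S \<Longrightarrow> q \<in> polys_over S \<Longrightarrow> p - q \<in> polys_over S"
    and "p \<in> polys_over S \<Longrightarrow> q \<in> polys_over S \<Longrightarrow> p + q \<in> polys_over S"
    and "p \<in> polys_over S \<Longrightarrow> q \<in> polys_over S \<Longrightarrow> p * q \<in> polys_over S"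
    and "a \<in> S \<Longrightarrow> q \<in> polys_over S \<Longrightarrow> smult a q \<in> polys_over S"
    and "a \<in> S \<Longrightarrow> Polynomial.monom a n \<in> polys_over S"
    and "q \<in> polys_over S \<Longrightarrow> pderiv q \<in> polys_over S"
proof -
  note S = unital_subringD[OF assms]
  show "0 \<in> polys_over S"
    and "p \<in> polys_over S \<Longrightarrow> q \<in> polys_over S \<Longrightarrow> p - q \<in> polys_over S"
    and plus: "p \<in> polys_over S \<Longrightarrow> q \<in> polys_over S \<Longrightarrow> p + q \<in> polys_over S"
    and smult: "a \<in> S \<Longrightarrow> q \<in> polys_over S \<Longrightarrow> smult a q \<in> polys_over S"
    and "a \<in> S \<Longrightarrow> Polynomial.monom a n \<in> polys_over S"
    and "q \<in> polys_over S \<Longrightarrow> pderiv q \<in> polys_over S" for p q a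
    using S by (auto simp: polys_over_def coeff_pderiv simp del: of_nat_Suc)
  show "p \<in> polys_over S \<Longrightarrow> q \<in> polys_over S \<Longrightarrow> p * q \<in> polys_over S"
    by (induction p rule: pCons_induct) (simp_all add: plus smult mult_pCons_left S)
qed

definition adjoin :: "'f::idom set \<Rightarrow> 'f \<Rightarrow> 'f set" where
  "adjoin S b = (\<lambda>q. poly q b) ` polys_over S"

lemma poly_in_adjoin: "q \<in> polys_over S \<Longrightarrow> poly q b \<in> adjoin S b"
  by (simp add: adjoin_def)

lemma unital_subring_adjoin:
  assumes "unital_subring S"
  shows "unital_subring (adjoin S b)" and "S \<subseteq> adjoin S b" and "b \<in> adjoin S b"
proof -
  note S = unital_subringD[OF assms] and P = polys_over_closed[OF assms]
  show "unital_subring (adjoin S b)"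
    unfolding unital_subring_def
  proof (intro conjI ballI)
    show "1 \<in> adjoin S b"
      using poly_in_adjoin[of "[:1:]" S b] S P by simp
    fix x y assume "x \<in> adjoin S b" "y \<in> adjoin S b"
    then obtain p q where "x = poly p b" "p \<in> polys_over S" "y = poly q b" "q \<in> polys_over S"
      by (auto simp: adjoin_def)
    then show "x - y \<in> adjoin S b" "x * y \<in> adjoin S b"
      using poly_in_adjoin[of "p - q" S b] poly_in_adjoin[of "p * q" S b] P by simp_all
  qed
  show "S \<subseteq> adjoin S b"
  proof
    fix a assume "a \<in> S" then show "a \<in> adjoin S b"
      using poly_in_adjoin[of "[:a:]" S b] P by simp
  qed
  show "b \<in> adjoin S b"
    using poly_in_adjoin[of "[:0, 1:]" S b] S P by simp
qed

lemma poly_in_subring: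
  assumes "unital_subring B" "S \<subseteq> B" "b \<in> B" "q \<in> polys_over S"
  shows "poly q b \<in> B"
  using assms(4)
  by (induction q rule: pCons_induct) (use unital_subringD[OF assms(1)] assms(2,3) in auto)

definition algebraic_over :: "'f::idom set \<Rightarrow> 'f \<Rightarrow> bool" where
  "algebraic_over S b \<longleftrightarrow> (\<exists>q\<in>polys_over S. q \<noteq> 0 \<and> poly q b = 0)"

lemma algebraic_over_minimal:
  assumes "algebraic_over S b"
  shows "\<exists>p\<in>polys_over S. p \<noteq> 0 \<and> poly p b = 0 \<and>
    (\<forall>q\<in>polys_over S. poly q b = 0 \<longrightarrow> q \<noteq> 0 \<longrightarrow> Polynomial.degree p \<le> Polynomial.degree q)"
proof -
  obtain q0 where "q0 \<in> polys_over S \<and> q0 \<noteq> 0 \<and> poly q0 b = 0"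
    using assms unfolding algebraic_over_def by blast
  from ex_has_least_nat[of "\<lambda>q. q \<in> polys_over S \<and> q \<noteq> 0 \<and> poly q b = 0", OF this,
      of Polynomial.degree]
  show ?thesis by blast
qed

definition derivation_on :: "'f::idom set \<Rightarrow> ('f \<Rightarrow> 'f) \<Rightarrow> bool" where
  "derivation_on S D \<longleftrightarrow> (\<forall>a\<in>S. \<forall>b\<in>S. D (a + b) = D a + D b \<and> D (a * b) = a * D b + D a * b)"

lemma derivation_onD:
  assumes "derivation_on S D" "unital_subring S"
  shows "a \<in> S \<Longrightarrow> b \<in> S \<Longrightarrow> D (a + b) = D a + D b"
    and "a \<in> S \<Longrightarrow> b \<in> S \<Longrightarrow> D (a * b) = a * D b + D a * b"
    and "D 0 = 0" and "D 1 = 0"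
    and "a \<in> S \<Longrightarrow> b \<in> S \<Longrightarrow> D (a - b) = D a - D b"
proof -
  note S = unital_subringD[OF assms(2)]
  show add: "a \<in> S \<Longrightarrow> b \<in> S \<Longrightarrow> D (a + b) = D a + D b"
    and mult: "a \<in> S \<Longrightarrow> b \<in> S \<Longrightarrow> D (a * b) = a * D b + D a * b" for a b
    using assms by (auto simp: derivation_on_def)
  show "D 0 = 0" using add[OF S(1) S(1)] by (metis add.right_neutral add_left_cancel)
  show "D 1 = 0"
    using mult[OF S(2) S(2)] by (metis add.right_neutral add_left_cancel mult_1 mult_1_right)
  show "a \<in> S \<Longrightarrow> b \<in> S \<Longrightarrow> D (a - b) = D a - D b"
    using add[of "a - b" b] S by simp
qed

text \<open>The only possible value at \<open>q(b)\<close> of an extension of \<open>D\<close> that sends \<open>b\<close> to \<open>d\<close>: the derivation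
  \<open>D\<close> applied to the coefficients, plus the chain rule term. As a function of \<open>q\<close> it is a derivation
  from polynomials to the field, along evaluation at \<open>b\<close>.\<close>

definition derive_at :: "('f::idom \<Rightarrow> 'f) \<Rightarrow> 'f \<Rightarrow> 'f \<Rightarrow> 'f poly \<Rightarrow> 'f" where
  "derive_at D b d q = poly (map_poly D q) b + poly (pderiv q) b * d"

context
  fixes S :: "'f::idom set" and D :: "'f \<Rightarrow> 'f" and b d :: 'f
  assumes S: "unital_subring S" and D: "derivation_on S D"
begin

lemma derive_at_0 [simp]: "derive_at D b d 0 = 0"
  by (simp add: derive_at_def)

lemma derive_at_pCons:
  "derive_at D b d (pCons a q) = D a + b * derive_at D b d q + poly q b * d"
  using derivation_onD(3)[OF D S]
  by (simp add: derive_at_def map_poly_pCons pderiv_pCons algebra_simps)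

lemma derive_at_diff:
  assumes "p \<in> polys_over S" "q \<in> polys_over S"
  shows "derive_at D b d (p - q) = derive_at D b d p - derive_at D b d q"
proof -
  have "map_poly D (p - q) = map_poly D p - map_poly D q"
    using assms derivation_onD[OF D S] by (intro poly_eqI) (simp add: coeff_map_poly polys_over_def)
  then show ?thesis unfolding derive_at_def pderiv_diff by (simp only: poly_diff left_diff_distrib)  simp
qed

lemma derive_at_add:
  assumes "p \<in> polys_over S" "q \<in> polys_over S"
  shows "derive_at D b d (p + q) = derive_at D b d p + derive_at D b d q"
proof -
  have "map_poly D (p + q) = map_poly D p + map_poly D q"
    using assms derivation_onD[OF D S] by (intro poly_eqI) (simp add: coeff_map_poly polys_over_def)
  then show ?thesis unfolding derive_at_def pderiv_add by (simp only: poly_add distrib_right) simp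
qed

lemma derive_at_smult:
  assumes "a \<in> S" "q \<in> polys_over S"
  shows "derive_at D b d (smult a q) = a * derive_at D b d q + D a * poly q b"
  using assms(2)
proof (induction q rule: pCons_induct)
  case (pCons c q)
  then show ?case
    using assms(1) derivation_onD(2)[OF D S, of a c] by (simp add: derive_at_pCons algebra_simps)
qed simp

lemma derive_at_mult:
  assumes "p \<in> polys_over S" "q \<in> polys_over S"
  shows "derive_at D b d (p * q) = poly p b * derive_at D b d q + derive_at D b d p * poly q b"
  using assms(1)
proof (induction p rule: pCons_induct)
  case (pCons a p)
  then have "p * q \<in> polys_over S"
    using assms(2) polys_over_closed(4)[OF S] by simp
  then show ?case
    using pCons assms(2) unital_subringD(1)[OF S] polys_over_closed[OF S] derivation_onD(3)[OF D S]
    by (simp add: derive_at_add derive_at_smult derive_at_pCons algebra_simps)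
qed simp

lemma extend_derivation_to_adjoin:
  assumes consistent: "\<And>q. q \<in> polys_over S \<Longrightarrow> poly q b = 0 \<Longrightarrow> derive_at D b d q = 0"
  shows "\<exists>D'. derivation_on (adjoin S b) D' \<and> (\<forall>a\<in>S. D' a = D a) \<and> D' b = d"
proof -
  note P = polys_over_closed[OF S]
  define D' where "D' z = derive_at D b d (SOME q. q \<in> polys_over S \<and> poly q b = z)" for z
  have D': "D' (poly q b) = derive_at D b d q" if q: "q \<in> polys_over S" for q
  proof -
    let ?r = "SOME r. r \<in> polys_over S \<and> poly r b = poly q b"
    have r: "?r \<in> polys_over S \<and> poly ?r b = poly q b"
      by (rule someI[of _ q]) (simp add: q)
    then have "derive_at D b d (?r - q) = 0"
      using q P by (intro consistent) simp_all
    then show ?thesis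
      using r q by (simp add: D'_def derive_at_diff)
  qed
  show ?thesis
  proof (intro exI[of _ D'] conjI ballI)
    show "derivation_on (adjoin S b) D'"
      unfolding derivation_on_def
    proof (intro ballI)
      fix x y assume "x \<in> adjoin S b" "y \<in> adjoin S b"
      then obtain p q where "x = poly p b" "p \<in> polys_over S" "y = poly q b" "q \<in> polys_over S"
        by (auto simp: adjoin_def)
      then show "D' (x + y) = D' x + D' y \<and> D' (x * y) = x * D' y + D' x * y"
        using D'[of "p + q"] D'[of "p * q"] P by (simp add: D' derive_at_add derive_at_mult)
    qed
    show "D' a = D a" if "a \<in> S" for a
      using D'[of "[:a:]"] that P by (simp add: derive_at_pCons)
    show "D' b = d"
      using D'[of "[:0, 1:]"] unital_subringD[OF S] derivation_onD[OF D S] P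
      by (simp add: derive_at_pCons)
  qed
qed

text \<open>A polynomial that vanishes at \<open>b\<close> is, up to a factor from \<open>S\<close>, a multiple of one of minimal
  degree, so it suffices to test consistency on the latter. The proof is one step of pseudo-division,
  which needs no inverses in \<open>S\<close>.\<close>

lemma derive_at_minimal_polynomial:
  assumes p: "p \<in> polys_over S" "p \<noteq> 0" "poly p b = 0" "derive_at D b d p = 0"
    and minimal: "\<And>q. q \<in> polys_over S \<Longrightarrow> poly q b = 0 \<Longrightarrow> q \<noteq> 0 \<Longrightarrow>
      Polynomial.degree p \<le> Polynomial.degree q"
    and q: "q \<in> polys_over S" "poly q b = 0"
  shows "derive_at D b d q = 0"
  using q
proof (induction "Polynomial.degree q" arbitrary: q rule: less_induct)
  case less
  note P = polys_over_closed[OF S]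
  show ?case
  proof (cases "q = 0")
    case False
    let ?a = "Polynomial.lead_coeff p" and ?c = "Polynomial.lead_coeff q"
    let ?k = "Polynomial.degree q - Polynomial.degree p"
    let ?r = "smult ?a q - Polynomial.monom ?c ?k * p"
    have le: "Polynomial.degree p \<le> Polynomial.degree q"
      using minimal less.prems False by blast
    have S_coeffs: "?a \<in> S" "?c \<in> S"
      using p less.prems by (auto simp: polys_over_def)
    have mem: "smult ?a q \<in> polys_over S" "Polynomial.monom ?c ?k \<in> polys_over S"
      "Polynomial.monom ?c ?k * p \<in> polys_over S"
      using S_coeffs less.prems p P by auto
    have r: "?r \<in> polys_over S" "poly ?r b = 0"
      using mem P less.prems p by simp_all
    have "Polynomial.degree (Polynomial.monom ?c ?k * p) \<le> Polynomial.degree q"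
      using degree_mult_le[of "Polynomial.monom ?c ?k" p] degree_monom_le[of ?c ?k] le by linarith
    then have "Polynomial.degree ?r \<le> Polynomial.degree q"
      by (intro degree_diff_le) (use degree_smult_le[of ?a q] in auto)
    moreover have "poly.coeff ?r (Polynomial.degree q) = 0"
      using le by (simp add: coeff_monom_mult)
    ultimately have "?r = 0 \<or> Polynomial.degree ?r < Polynomial.degree q"
      by (metis leading_coeff_0_iff le_neq_implies_less)
    then have "derive_at D b d ?r = 0"
      using less.hyps[of ?r] r by auto
    then have "?a * derive_at D b d q = 0"
      using mem S_coeffs less.prems p by (simp add: derive_at_diff derive_at_smult derive_at_mult)
    then show ?thesis using p(2) by simp
  qed simp
qed

end

lemma derivation_on_poly:
  assumes B: "unital_subring B" "derivation_on B D" "b \<in> B" and S: "S \<subseteq> B" "q \<in> polys_over S"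
  shows "D (poly q b) = derive_at D b (D b) q"
  using S(2)
proof (induction q rule: pCons_induct)
  case 0
  then show ?case using derivation_onD(3)[OF B(2,1)] derive_at_0[OF B(1,2)] by simp
next
  case (pCons a q)
  have "poly q b \<in> B"
    using pCons.prems poly_in_subring[OF B(1) S(1) B(3)] by simp
  then show ?case
    using pCons B S unital_subringD[OF B(1)] derivation_onD[OF B(2,1)]
    by (auto simp: derive_at_pCons[OF B(1,2)] algebra_simps)
qed

section \<open>Differential bases\<close>

text \<open>A derivation of \<open>B\<close> is the same as a derivation of \<open>S\<close> together with arbitrary values on \<open>T\<close>.
  For an extension of fields in characteristic 0 these \<open>T\<close> are the finite transcendence bases. Keeping \<open>T\<close>
  disjoint from \<open>S\<close> makes the notion transitive: values prescribed on two steps of a tower cannot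
  contradict each other.\<close>

definition differential_basis :: "'f::idom set \<Rightarrow> 'f set \<Rightarrow> 'f set \<Rightarrow> bool" where
  "differential_basis S B T \<longleftrightarrow> S \<subseteq> B \<and> finite T \<and> T \<subseteq> B - S \<and>
     (\<forall>D e. derivation_on S D \<longrightarrow>
        (\<exists>D'. derivation_on B D' \<and> (\<forall>a\<in>S. D' a = D a) \<and> (\<forall>t\<in>T. D' t = e t))) \<and>
     (\<forall>D D'. derivation_on B D \<longrightarrow> derivation_on B D' \<longrightarrow> (\<forall>a\<in>S \<union> T. D a = D' a) \<longrightarrow>
        (\<forall>a\<in>B. D a = D' a))"

lemma derivation_on_mono: "derivation_on B D \<Longrightarrow> S \<subseteq> B \<Longrightarrow> derivation_on S D"
  unfolding derivation_on_def by blast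

lemma differential_basis_refl: "differential_basis S S {}"
  unfolding differential_basis_def by blast

lemma differential_basisD:
  assumes "differential_basis S B T"
  shows "S \<subseteq> B" and "finite T" and "T \<subseteq> B - S"
    and "derivation_on S D \<Longrightarrow>
      \<exists>D'. derivation_on B D' \<and> (\<forall>a\<in>S. D' a = D a) \<and> (\<forall>t\<in>T. D' t = e t)"
    and "\<lbrakk>derivation_on B D1; derivation_on B D2; \<And>a. a \<in> S \<Longrightarrow> D1 a = D2 a;
      \<And>t. t \<in> T \<Longrightarrow> D1 t = D2 t; z \<in> B\<rbrakk> \<Longrightarrow> D1 z = D2 z"
proof -
  note b = assms[unfolded differential_basis_def]
  show "S \<subseteq> B" using b by (elim conjE)
  show "finite T" using b by (elim conjE)
  show "T \<subseteq> B - S" using b by (elim conjE)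
  show "derivation_on S D \<Longrightarrow>
      \<exists>D'. derivation_on B D' \<and> (\<forall>a\<in>S. D' a = D a) \<and> (\<forall>t\<in>T. D' t = e t)"
    using b[THEN conjunct2, THEN conjunct2, THEN conjunct2, THEN conjunct1] by simp
  show "\<lbrakk>derivation_on B D1; derivation_on B D2; \<And>a. a \<in> S \<Longrightarrow> D1 a = D2 a;
      \<And>t. t \<in> T \<Longrightarrow> D1 t = D2 t; z \<in> B\<rbrakk> \<Longrightarrow> D1 z = D2 z"
    using b[THEN conjunct2, THEN conjunct2, THEN conjunct2, THEN conjunct2, rule_format, of D1 D2 z]
    by auto
qed

lemma differential_basis_trans:
  assumes 1: "differential_basis R S T" and 2: "differential_basis S B U"
  shows "differential_basis R B (T \<union> U)"
  unfolding differential_basis_def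
proof (intro conjI allI impI)
  note d1 = differential_basisD[OF 1] and d2 = differential_basisD[OF 2]
  show "R \<subseteq> B" "finite (T \<union> U)" "T \<union> U \<subseteq> B - R"
    using d1(1-3) d2(1-3) by auto
  show "\<exists>D'. derivation_on B D' \<and> (\<forall>a\<in>R. D' a = D a) \<and> (\<forall>t\<in>T \<union> U. D' t = e t)"
    if D: "derivation_on R D" for D e
  proof -
    obtain D1 where D1: "derivation_on S D1" "\<forall>a\<in>R. D1 a = D a" "\<forall>t\<in>T. D1 t = e t"
      using d1(4)[OF D, of e] by blast
    obtain D2 where D2: "derivation_on B D2" "\<forall>a\<in>S. D2 a = D1 a" "\<forall>t\<in>U. D2 t = e t"
      using d2(4)[OF D1(1), of e] by blast
    have "\<forall>a\<in>R. D2 a = D a" "\<forall>t\<in>T. D2 t = e t"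
      using D1 D2 d1(1,3) by auto
    then show ?thesis using D2 by blast
  qed
  fix D D' assume D: "derivation_on B D" "derivation_on B D'" "\<forall>a\<in>R \<union> (T \<union> U). D a = D' a"
  have "D a = D' a" if "a \<in> S" for a
    using d1(5)[of D D' a] derivation_on_mono[OF D(1) d2(1)] derivation_on_mono[OF D(2) d2(1)] D(3) that
    by blast
  then show "\<forall>a\<in>B. D a = D' a"
    using d2(5)[of D D'] D by blast
qed

text \<open>Without relations for \<open>b\<close> there is nothing to be consistent with.\<close>

lemma differential_basis_adjoin_transcendental:
  assumes S: "unital_subring S" and b: "\<not> algebraic_over S b"
  shows "differential_basis S (adjoin S b) {b}"
  unfolding differential_basis_def
proof (intro conjI allI impI)
  note A = unital_subring_adjoin[OF S, of b]
  show "S \<subseteq> adjoin S b" "finite {b}" using A by simp_all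
  have "b \<notin> S"
  proof
    assume "b \<in> S"
    then have "[:- b, 1:] \<in> polys_over S"
      using unital_subringD[OF S] polys_over_closed(1)[OF S] by simp
    moreover have "[:- b, 1:] \<noteq> 0" "poly [:- b, 1:] b = 0" by simp_all
    ultimately show False using b unfolding algebraic_over_def by blast
  qed
  then show "{b} \<subseteq> adjoin S b - S" using A by simp
  show "\<exists>D'. derivation_on (adjoin S b) D' \<and> (\<forall>a\<in>S. D' a = D a) \<and> (\<forall>t\<in>{b}. D' t = e t)"
    if D: "derivation_on S D" for D e
  proof -
    have "derive_at D b (e b) q = 0" if "q \<in> polys_over S" "poly q b = 0" for q
    proof -
      have "q = 0" using that b unfolding algebraic_over_def by blast
      then show ?thesis by (simp add: derive_at_0[OF S D])
    qed
    from extend_derivation_to_adjoin[OF S D this] show ?thesis by simp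
  qed
  fix D D' assume D: "derivation_on (adjoin S b) D" "derivation_on (adjoin S b) D'"
    "\<forall>a\<in>S \<union> {b}. D a = D' a"
  show "\<forall>a\<in>adjoin S b. D a = D' a"
  proof
    fix z assume "z \<in> adjoin S b"
    then obtain q where q: "z = poly q b" "q \<in> polys_over S" by (auto simp: adjoin_def)
    have "D 0 = 0" "D' 0 = 0"
      using derivation_onD(3)[OF D(1) A(1)] derivation_onD(3)[OF D(2) A(1)] .
    then have "map_poly D q = map_poly D' q"
      using q D(3) by (intro poly_eqI) (simp add: coeff_map_poly polys_over_def)
    then show "D z = D' z"
      using D(3) derivation_on_poly[OF A(1) D(1) A(3,2) q(2)]
        derivation_on_poly[OF A(1) D(2) A(3,2) q(2)]
      by (simp add: q derive_at_def)
  qed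
qed

text \<open>If \<open>p\<close> has minimal degree among the nonzero polynomials over \<open>S\<close> that vanish at \<open>b\<close>, then
  \<open>p'(b) \<noteq> 0\<close> in characteristic 0, and \<open>0 = D(p(b)) = (D p)(b) + p'(b) D(b)\<close> determines \<open>D(b)\<close>.
  Characteristic 0 is a hypothesis rather than a type class, since the lemma is applied to fields of
  fractions of arbitrary domains.\<close>

lemma differential_basis_adjoin_algebraic:
  fixes b :: "'f::field"
  assumes char_0: "\<And>n. of_nat (Suc n) \<noteq> (0::'f)"
    and S: "unital_subring S" and b: "algebraic_over S b"
  shows "differential_basis S (adjoin S b) {}"
  unfolding differential_basis_def
proof (intro conjI allI impI)
  note A = unital_subring_adjoin[OF S, of b]
  show "S \<subseteq> adjoin S b" "finite {}" "{} \<subseteq> adjoin S b - S" using A by simp_all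
  obtain p where p: "p \<in> polys_over S" "p \<noteq> 0" "poly p b = 0"
    and min: "\<forall>q\<in>polys_over S. poly q b = 0 \<longrightarrow> q \<noteq> 0 \<longrightarrow> Polynomial.degree p \<le> Polynomial.degree q"
    using algebraic_over_minimal[OF b] by blast
  note minimal = min[rule_format]
  have "Polynomial.degree p \<noteq> 0"
  proof
    assume "Polynomial.degree p = 0"
    then obtain a where "p = [:a:]" by (rule degree_eq_zeroE)
    then show False using p(2,3) by simp
  qed
  then obtain n where n: "Polynomial.degree p = Suc n" by (cases "Polynomial.degree p") auto
  have "poly.coeff (pderiv p) n \<noteq> 0"
    using char_0[of n] p(2) by (simp add: coeff_pderiv flip: n del: of_nat_Suc)
  then have "pderiv p \<noteq> 0" by auto
  moreover have "Polynomial.degree (pderiv p) < Polynomial.degree p"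
  proof -
    have "Polynomial.degree (pderiv p) \<le> n"
      by (rule degree_le) (simp add: coeff_pderiv coeff_eq_0 n)
    then show ?thesis using n by simp
  qed
  ultimately have separable: "poly (pderiv p) b \<noteq> 0"
    using minimal[of "pderiv p"] polys_over_closed(7)[OF S p(1)] by auto
  show "\<exists>D'. derivation_on (adjoin S b) D' \<and> (\<forall>a\<in>S. D' a = D a) \<and> (\<forall>t\<in>{}. D' t = e t)"
    if D: "derivation_on S D" for D e
  proof -
    \<comment> \<open>the solution of \<open>(D p)(b) + p'(b) d = 0\<close>\<close>
    let ?d = "- poly (map_poly D p) b / poly (pderiv p) b"
    have "derive_at D b ?d p = 0"
      using separable by (simp add: derive_at_def)
    note derive_at_minimal_polynomial[OF S D p this minimal]
    from extend_derivation_to_adjoin[OF S D this] show ?thesis by blast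
  qed
  fix D D' assume D: "derivation_on (adjoin S b) D" "derivation_on (adjoin S b) D'"
    "\<forall>a\<in>S \<union> {}. D a = D' a"
  have zero: "D 0 = 0" "D' 0 = 0"
    using derivation_onD(3)[OF D(1) A(1)] derivation_onD(3)[OF D(2) A(1)] .
  have same: "map_poly D q = map_poly D' q" if "q \<in> polys_over S" for q
    using that D(3) zero by (intro poly_eqI) (simp add: coeff_map_poly polys_over_def)
  note eval = derivation_on_poly[OF A(1) D(1) A(3,2)] derivation_on_poly[OF A(1) D(2) A(3,2)]
  have "poly (map_poly D p) b + poly (pderiv p) b * D b
      = poly (map_poly D p) b + poly (pderiv p) b * D' b"
    using eval[OF p(1)] p(3) zero same[OF p(1)] by (simp add: derive_at_def)
  then have "poly (pderiv p) b * D b = poly (pderiv p) b * D' b" by (rule add_left_imp_eq)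
  then have "D b = D' b" using separable by simp
  show "\<forall>a\<in>adjoin S b. D a = D' a"
  proof
    fix z assume "z \<in> adjoin S b"
    then obtain q where q: "z = poly q b" "q \<in> polys_over S" by (auto simp: adjoin_def)
    then show "D z = D' z"
      using \<open>D b = D' b\<close> eval[OF q(2)] same[OF q(2)] by (simp add: derive_at_def)
  qed
qed

lemma quotient_rule_on:
  fixes D :: "'f::field \<Rightarrow> 'f"
  assumes "unital_subring S" "derivation_on S D" "a \<in> S" "b \<in> S" "b \<noteq> 0" "a / b \<in> S"
  shows "D (a / b) = (D a * b - a * D b) / b\<^sup>2"
proof -
  have "D (a / b * b) = a / b * D b + D (a / b) * b"
    using assms derivation_onD by blast
  then show ?thesis using assms(5) by (simp add: field_simps power2_eq_square)
qed

text \<open>The quotient rule defines the extension. Independence of the chosen fraction follows by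
  differentiating \<open>a b' = a' b\<close>.\<close>

lemma differential_basis_fractions:
  fixes S :: "'f::field set"
  assumes S: "unital_subring S" and frac: "\<And>z. \<exists>a\<in>S. \<exists>b\<in>S. b \<noteq> 0 \<and> z = a / b"
  shows "differential_basis S UNIV {}"
  unfolding differential_basis_def
proof (intro conjI allI impI)
  have UNIV: "unital_subring (UNIV :: 'f set)" by (simp add: unital_subring_def)
  show "S \<subseteq> UNIV" "finite {}" "{} \<subseteq> UNIV - S" by simp_all
  show "\<exists>D'. derivation_on UNIV D' \<and> (\<forall>a\<in>S. D' a = D a) \<and> (\<forall>t\<in>{}. D' t = e t)"
    if D: "derivation_on S D" for D e
  proof -
    note DS = derivation_onD[OF D S] and S' = unital_subringD[OF S]
    obtain num den where nd: "\<And>z. num z \<in> S \<and> den z \<in> S \<and> den z \<noteq> 0 \<and> z = num z / den z"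
      using frac by metis
    define D' where "D' z = (D (num z) * den z - num z * D (den z)) / (den z)\<^sup>2" for z
    have D': "D' (a / b) = (D a * b - a * D b) / b\<^sup>2" if ab: "a \<in> S" "b \<in> S" "b \<noteq> 0" for a b
    proof -
      let ?a = "num (a / b)" and ?b = "den (a / b)"
      have nd': "?a \<in> S" "?b \<in> S" "?b \<noteq> 0" "a / b = ?a / ?b" using nd by blast+
      have cross: "a * ?b = ?a * b" using nd'(3,4) ab(3) by (simp add: frac_eq_eq)
      have Dcross: "a * D ?b + D a * ?b = ?a * D b + D ?a * b"
        using arg_cong[OF cross, of D] DS(2) nd' ab by simp
      have "(D ?a * ?b - ?a * D ?b) * b\<^sup>2
          = b * ?b * (?a * D b + D ?a * b) - b * ?b * D b * ?a - b * D ?b * (?a * b)"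
        by (simp only: power2_eq_square) (simp add: algebra_simps)
      also have "\<dots> = b * ?b * (a * D ?b + D a * ?b) - ?b * D b * (a * ?b) - b * D ?b * (a * ?b)"
        by (simp only: cross Dcross) (simp add: algebra_simps)
      also have "\<dots> = (D a * b - a * D b) * ?b\<^sup>2"
        by (simp only: power2_eq_square) (simp add: algebra_simps)
      finally have "(D ?a * ?b - ?a * D ?b) * b\<^sup>2 = (D a * b - a * D b) * ?b\<^sup>2" .
      then show ?thesis
        unfolding D'_def using nd'(3) ab(3) by (simp add: frac_eq_eq)
    qed
    have "D' (x + y) = D' x + D' y \<and> D' (x * y) = x * D' y + D' x * y" for x y
    proof -
      obtain a b where x: "a \<in> S" "b \<in> S" "b \<noteq> 0" "x = a / b" using frac by blast
      obtain c d where y: "c \<in> S" "d \<in> S" "d \<noteq> 0" "y = c / d" using frac by blast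
      have xy: "x + y = (a * d + c * b) / (b * d)" "x * y = (a * c) / (b * d)"
        using x y by (simp_all add: add_frac_eq)
      have Dsum: "D (a * d + c * b) = a * D d + D a * d + (c * D b + D c * b)"
        and Dprod: "D (b * d) = b * D d + D b * d" "D (a * c) = a * D c + D a * c"
        using x y S' by (simp_all add: DS)
      have bd: "b\<^sup>2 \<noteq> 0" "d\<^sup>2 \<noteq> 0" "(b * d)\<^sup>2 \<noteq> 0" using x(3) y(3) by simp_all
      have "D' (x + y) = ((a * D d + D a * d + (c * D b + D c * b)) * (b * d)
          - (a * d + c * b) * (b * D d + D b * d)) / (b * d)\<^sup>2"
        unfolding xy using x y S' by (subst D') (simp_all add: Dsum Dprod)
      also have "\<dots> = ((D a * b - a * D b) * d\<^sup>2 + (D c * d - c * D d) * b\<^sup>2) / (b\<^sup>2 * d\<^sup>2)"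
        unfolding power_mult_distrib
        by (rule arg_cong2[where f = "(/)", OF _ refl]) (simp add: algebra_simps power2_eq_square)
      also have "\<dots> = D' x + D' y"
        using bd D'[OF x(1-3)] D'[OF y(1-3)] unfolding x(4) y(4) by (simp add: add_frac_eq)
      finally have "D' (x + y) = D' x + D' y" .
      moreover have "D' (x * y) = x * D' y + D' x * y"
      proof -
        have "D' (x * y) = ((a * D c + D a * c) * (b * d) - (a * c) * (b * D d + D b * d)) / (b * d)\<^sup>2"
          unfolding xy using x y S' by (subst D') (simp_all add: Dprod)
        also have "\<dots> = (a * b * (D c * d - c * D d) + (D a * b - a * D b) * c * d) / (b\<^sup>2 * d\<^sup>2)"
          unfolding power_mult_distrib
          by (rule arg_cong2[where f = "(/)", OF _ refl]) (simp add: algebra_simps)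
        also have "\<dots> = a / b * ((D c * d - c * D d) / d\<^sup>2) + (D a * b - a * D b) / b\<^sup>2 * (c / d)"
          using x(3) y(3) by (simp add: add_frac_eq frac_eq_eq power2_eq_square) (simp add: algebra_simps)
        finally show ?thesis using D'[OF x(1-3)] D'[OF y(1-3)] unfolding x(4) y(4) by simp
      qed
      ultimately show ?thesis by blast
    qed
    then have "derivation_on UNIV D'" by (simp add: derivation_on_def)
    moreover have "D' a = D a" if "a \<in> S" for a
      using D'[of a 1] that S' DS by simp
    ultimately show ?thesis by blast
  qed
  fix D D' :: "'f \<Rightarrow> 'f"
  assume D: "derivation_on UNIV D" "derivation_on UNIV D'" "\<forall>a\<in>S \<union> {}. D a = D' a"
  show "\<forall>z\<in>UNIV. D z = D' z"
  proof
    fix z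
    obtain a b where "a \<in> S" "b \<in> S" "b \<noteq> 0" "z = a / b" using frac by blast
    then show "D z = D' z"
      using quotient_rule_on[OF UNIV D(1), of a b] quotient_rule_on[OF UNIV D(2), of a b] D(3) by simp
  qed
qed

lemma differential_basis_finite_extension:
  fixes S :: "'f::field set"
  assumes char_0: "\<And>n. of_nat (Suc n) \<noteq> (0::'f)"
    and S: "unital_subring S" and "finite V"
  shows "\<exists>B T. unital_subring B \<and> V \<subseteq> B \<and> differential_basis S B T"
  using \<open>finite V\<close>
proof (induction V)
  case empty
  then show ?case using S differential_basis_refl by blast
next
  case (insert x V)
  then obtain B T where B: "unital_subring B" "V \<subseteq> B" "differential_basis S B T" by blast
  obtain U where "differential_basis B (adjoin B x) U"
    using differential_basis_adjoin_transcendental[OF B(1)]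
      differential_basis_adjoin_algebraic[OF char_0 B(1)] by blast
  from differential_basis_trans[OF B(3) this]
  show ?case using unital_subring_adjoin[OF B(1), of x] B(2) by blast
qed

section \<open>Partial derivatives and the divergence\<close>

text \<open>The field plays the role of a function field, with coordinates \<open>T\<close> over the constants \<open>S\<close>.\<close>

locale partial_derivations =
  fixes S T :: "'f::field set" and \<delta> :: "'f \<Rightarrow> 'f \<Rightarrow> 'f"
  assumes basis: "differential_basis S UNIV T"
    and partial_derivation: "t \<in> T \<Longrightarrow> derivation_on UNIV (\<delta> t)"
    and partial_constant: "t \<in> T \<Longrightarrow> a \<in> S \<Longrightarrow> \<delta> t a = 0"
    and partial_dual: "t \<in> T \<Longrightarrow> s \<in> T \<Longrightarrow> \<delta> t s = (if s = t then 1 else 0)"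
begin

lemma subring_UNIV: "unital_subring (UNIV :: 'f set)"
  by (simp add: unital_subring_def)

lemma finite_T: "finite T"
  using differential_basisD(2)[OF basis] .

definition vector_field :: "('f \<Rightarrow> 'f) \<Rightarrow> bool" where
  "vector_field V \<longleftrightarrow> derivation_on UNIV V \<and> (\<forall>a\<in>S. V a = 0)"

lemma vector_fieldD:
  assumes "vector_field V"
  shows "V (a + b) = V a + V b" "V (a * b) = a * V b + V a * b" "V 0 = 0" "V 1 = 0"
    "V (a - b) = V a - V b" "a \<in> S \<Longrightarrow> V a = 0" "V (sum g I) = (\<Sum>i\<in>I. V (g i))"
proof -
  note d = derivation_onD[OF assms[unfolded vector_field_def, THEN conjunct1] subring_UNIV]
  show *: "V (a + b) = V a + V b" "V 0 = 0" for a b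
    using d(1,3) by simp_all
  show "V (a * b) = a * V b + V a * b" "V 1 = 0" "V (a - b) = V a - V b"
    using d(2,4,5) by simp_all
  show "a \<in> S \<Longrightarrow> V a = 0"
    using assms by (simp add: vector_field_def)
  show "V (sum g I) = (\<Sum>i\<in>I. V (g i))"
    by (induction I rule: infinite_finite_induct) (simp_all add: *)
qed

lemma vector_field_partial: "t \<in> T \<Longrightarrow> vector_field (\<delta> t)"
  by (simp add: vector_field_def partial_derivation partial_constant)

lemma vector_field_commutator:
  assumes V: "vector_field V" and W: "vector_field W"
  shows "vector_field (\<lambda>z. V (W z) - W (V z))"
  unfolding vector_field_def derivation_on_def
  by (simp add: vector_fieldD[OF V] vector_fieldD[OF W] algebra_simps)

text \<open>Both sides are derivations over \<open>S\<close> with the same values on \<open>T\<close>.\<close>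

lemma vector_field_expansion:
  assumes V: "vector_field V"
  shows "V z = (\<Sum>t\<in>T. V t * \<delta> t z)"
proof -
  let ?W = "\<lambda>z. \<Sum>t\<in>T. V t * \<delta> t z"
  note p = vector_fieldD[OF vector_field_partial]
  have "?W (a + b) = ?W a + ?W b" for a b
    unfolding sum.distrib[symmetric] by (intro sum.cong refl) (simp add: p(1) distrib_left)
  moreover have "?W (a * b) = a * ?W b + ?W a * b" for a b
    unfolding sum_distrib_left sum_distrib_right sum.distrib[symmetric]
    by (intro sum.cong refl) (simp add: p(2) algebra_simps)
  ultimately have W: "derivation_on UNIV ?W" by (simp add: derivation_on_def)
  have dual: "?W t = V t" if "t \<in> T" for t
  proof -
    have "?W t = (\<Sum>s\<in>T. if s = t then V s else 0)"
      using that by (intro sum.cong refl) (auto simp: partial_dual)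
    then show ?thesis using that finite_T by simp
  qed
  have const: "?W a = V a" if "a \<in> S" for a
    using that by (simp add: p(6) vector_fieldD(6)[OF V])
  have "derivation_on UNIV V" using V unfolding vector_field_def by (rule conjunct1)
  then show ?thesis
    by (rule differential_basisD(5)[OF basis _ W]) (simp_all only: const dual UNIV_I)
qed

definition divergence :: "('f \<Rightarrow> 'f) \<Rightarrow> 'f" where
  "divergence V = (\<Sum>t\<in>T. \<delta> t (V t))"

lemma divergence_add: "divergence (\<lambda>z. V z + W z) = divergence V + divergence W"
  unfolding divergence_def sum.distrib[symmetric]
  by (intro sum.cong refl) (simp add: vector_fieldD(1)[OF vector_field_partial])

lemma divergence_mult:
  assumes V: "vector_field V"
  shows "divergence (\<lambda>z. a * V z) = a * divergence V + V a"
proof -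
  have "divergence (\<lambda>z. a * V z) = a * divergence V + (\<Sum>t\<in>T. V t * \<delta> t a)"
    unfolding divergence_def sum_distrib_left sum.distrib[symmetric]
    by (intro sum.cong refl) (simp add: vector_fieldD(2)[OF vector_field_partial] mult.commute)
  then show ?thesis using vector_field_expansion[OF V, of a] by simp
qed

text \<open>The divergence is a 1-cocycle. By the expansion in coordinates, the commutator of \<open>\<delta> t\<close> with \<open>V\<close> is
  \<open>\<Sum>s\<in>T. \<delta> t (V s) * \<delta> s\<close>, because \<open>V\<close> kills the constants \<open>\<delta> t s\<close>. The resulting double sum is
  symmetric in \<open>V\<close> and \<open>W\<close>, and cancels.\<close>

lemma divergence_commutator:
  assumes V: "vector_field V" and W: "vector_field W"
  shows "divergence (\<lambda>z. V (W z) - W (V z)) = V (divergence W) - W (divergence V)"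
proof -
  have twist: "\<delta> t (V z) = V (\<delta> t z) + (\<Sum>s\<in>T. \<delta> t (V s) * \<delta> s z)"
    if t: "t \<in> T" and V: "vector_field V" for t V z
  proof -
    have zero: "V (\<delta> t s) = 0" if "s \<in> T" for s
      using t that vector_fieldD(3,4)[OF V] by (simp add: partial_dual)
    have "\<delta> t (V z) - V (\<delta> t z) = (\<Sum>s\<in>T. (\<delta> t (V s) - V (\<delta> t s)) * \<delta> s z)"
      by (rule vector_field_expansion[OF vector_field_commutator[OF vector_field_partial[OF t] V]])
    also have "\<dots> = (\<Sum>s\<in>T. \<delta> t (V s) * \<delta> s z)"
      by (intro sum.cong refl) (simp add: zero)
    finally show ?thesis by (simp only: diff_eq_eq add.commute)
  qed
  have "divergence (\<lambda>z. V (W z) - W (V z)) = (\<Sum>t\<in>T. \<delta> t (V (W t)) - \<delta> t (W (V t)))"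
    unfolding divergence_def by (intro sum.cong refl vector_fieldD(5) vector_field_partial)
  also have "\<dots> = (\<Sum>t\<in>T. (V (\<delta> t (W t)) + (\<Sum>s\<in>T. \<delta> t (V s) * \<delta> s (W t)))
      - (W (\<delta> t (V t)) + (\<Sum>s\<in>T. \<delta> t (W s) * \<delta> s (V t))))"
    by (intro sum.cong refl arg_cong2[where f = "(-)"] twist V W)
  also have "\<dots> = V (divergence W) + (\<Sum>t\<in>T. \<Sum>s\<in>T. \<delta> t (V s) * \<delta> s (W t))
      - (W (divergence V) + (\<Sum>t\<in>T. \<Sum>s\<in>T. \<delta> t (W s) * \<delta> s (V t)))"
    by (simp only: divergence_def vector_fieldD(7)[OF V] vector_fieldD(7)[OF W] sum.distrib sum_subtractf)
  also have "(\<Sum>t\<in>T. \<Sum>s\<in>T. \<delta> t (V s) * \<delta> s (W t)) = (\<Sum>t\<in>T. \<Sum>s\<in>T. \<delta> t (W s) * \<delta> s (V t))"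
    by (subst sum.swap) (simp only: mult.commute)
  finally show ?thesis by simp
qed

end

lemma partial_derivations_exist:
  assumes T: "differential_basis S UNIV T"
  obtains \<delta> where "partial_derivations S T \<delta>"
proof -
  have "derivation_on S (\<lambda>_. 0)" by (simp add: derivation_on_def)
  from differential_basisD(4)[OF T this]
  have "\<exists>D'. derivation_on UNIV D' \<and> (\<forall>a\<in>S. D' a = 0) \<and> (\<forall>s\<in>T. D' s = (if s = t then 1 else 0))"
    for t .
  then obtain \<delta> where "\<And>t. derivation_on UNIV (\<delta> t) \<and> (\<forall>a\<in>S. \<delta> t a = 0) \<and>
      (\<forall>s\<in>T. \<delta> t s = (if s = t then 1 else 0))"
    by metis
  then show ?thesis
    using that[of \<delta>] T unfolding partial_derivations_def by blast
qed

section \<open>Finite generation of annihilators in enveloping algebras\<close>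

text \<open>The correspondence between right ideals of a quotient ring and right ideals containing \<open>J\<close>,
  in the form that allows finite generation to be used without leaving the ring \<open>F\<close>.\<close>

lemma right_noetherian_quotient:
  fixes F (structure)
  assumes "ring F" and J: "ideal J F" and noeth: "right_noetherian (F Quot J)"
    and Q: "right_ideal Q F"
  obtains S where "finite S" "S \<subseteq> Q"
    "\<And>Q'. right_ideal Q' F \<Longrightarrow> J \<subseteq> Q' \<Longrightarrow> S \<subseteq> Q' \<Longrightarrow> Q \<subseteq> Q'"
proof -
  interpret F: ring F by fact
  interpret J: ideal J F by fact
  let ?q = "\<lambda>a. J +> a"
  interpret q: ring_hom_ring F "F Quot J" ?q by (rule J.rcos_ring_hom_ring)
  have image: "right_ideal (?q ` I) (F Quot J)" if I: "right_ideal I F" for I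
    unfolding right_ideal_def
  proof (intro conjI ballI)
    show "additive_subgroup (?q ` I) (F Quot J)"
      using I q.img_is_add_subgroup unfolding right_ideal_def additive_subgroup_def by blast
  next
    fix a r assume a: "a \<in> ?q ` I" and r: "r \<in> carrier (F Quot J)"
    obtain a' where a': "a = ?q a'" "a' \<in> I" using a by blast
    obtain r' where r': "r = ?q r'" "r' \<in> carrier F"
      using r unfolding FactRing_def A_RCOSETS_def' by auto
    have "a' \<in> carrier F"
      using a' I additive_subgroup.a_Hcarr unfolding right_ideal_def by metis
    then have "a \<otimes>\<^bsub>F Quot J\<^esub> r = ?q (a' \<otimes> r')"
      using a' r' by simp
    moreover have "a' \<otimes> r' \<in> I"
      using I a' r' unfolding right_ideal_def by blast
    ultimately show "a \<otimes>\<^bsub>F Quot J\<^esub> r \<in> ?q ` I" by blast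
  qed
  obtain S0 where S0: "finite S0" "?q ` Q = (\<lambda>I. right_ideal I (F Quot J)) hull S0"
    using noeth image[OF Q] unfolding right_noetherian_def by blast
  then have "S0 \<subseteq> ?q ` Q" by (simp add: hull_subset)
  then obtain S where S: "finite S" "S \<subseteq> Q" "S0 = ?q ` S"
    using S0(1) by (meson finite_subset_image)
  show ?thesis
  proof (rule that[OF S(1,2)])
    fix Q' assume Q': "right_ideal Q' F" "J \<subseteq> Q'" "S \<subseteq> Q'"
    have "?q ` Q \<subseteq> ?q ` Q'"
      unfolding S0(2) by (rule hull_minimal) (use S Q' image in auto)
    show "Q \<subseteq> Q'"
    proof
      fix f assume f: "f \<in> Q"
      then obtain g where g: "g \<in> Q'" "?q f = ?q g"
        using \<open>?q ` Q \<subseteq> ?q ` Q'\<close> by blast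
      interpret Q': additive_subgroup Q' F using Q' unfolding right_ideal_def by blast
      have [simp]: "f \<in> carrier F" "g \<in> carrier F"
        using f Q g Q'.a_Hcarr additive_subgroup.a_Hcarr unfolding right_ideal_def by metis+
      have "f \<ominus> g \<in> Q'"
        using F.quotient_eq_iff_same_a_r_cos[OF J] g(2) Q'(2) by auto
      then have "(f \<ominus> g) \<oplus> g \<in> Q'" using g by simp
      also have "(f \<ominus> g) \<oplus> g = f"
        by (simp add: F.minus_eq F.a_assoc F.l_neg)
      finally show "f \<in> Q'" .
    qed
  qed
qed

text \<open>A module over \<open>\<LL>\<close> is a module over its enveloping algebra. Computations take place in the
  tensor algebra \<open>tensors\<close>, where elements are represented by words; the defining relations of the
  enveloping algebra act by zero.\<close>

locale lie_module = lie_algebra \<LL> + M: vector_space scaleM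
  for \<LL> :: "('k::field, 'v::ab_group_add) lie_alg" and scaleM :: "'k \<Rightarrow> 'm::ab_group_add \<Rightarrow> 'm" +
  fixes act :: "'v \<Rightarrow> 'm \<Rightarrow> 'm"
  assumes act_add_right: "x \<in> vectors \<LL> \<Longrightarrow> act x (m + n) = act x m + act x n"
    and act_scale_right: "x \<in> vectors \<LL> \<Longrightarrow> act x (scaleM c m) = scaleM c (act x m)"
    and act_add_left: "\<lbrakk>x \<in> vectors \<LL>; y \<in> vectors \<LL>\<rbrakk> \<Longrightarrow> act (x + y) m = act x m + act y m"
    and act_scale_left: "x \<in> vectors \<LL> \<Longrightarrow> act (smul \<LL> c x) m = scaleM c (act x m)"
    and act_bracket: "\<lbrakk>x \<in> vectors \<LL>; y \<in> vectors \<LL>\<rbrakk> \<Longrightarrow>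
      act (bracket \<LL> x y) m = act x (act y m) - act y (act x m)"
begin

abbreviation tensors :: "('v fword \<Rightarrow>\<^sub>0 'k) ring" where
  "tensors \<equiv> free_algebra (vectors \<LL>)"

abbreviation act_word :: "'v fword \<Rightarrow> 'm \<Rightarrow> 'm" where
  "act_word w m \<equiv> foldr act (letters w) m"

definition act_tensor :: "('v fword \<Rightarrow>\<^sub>0 'k) \<Rightarrow> 'm \<Rightarrow> 'm" where
  "act_tensor f m = (\<Sum>w\<in>Poly_Mapping.keys f. scaleM (Poly_Mapping.lookup f w) (act_word w m))"

lemma act_word_add:
  "set (letters w) \<subseteq> vectors \<LL> \<Longrightarrow> act_word w (m + n) = act_word w m + act_word w n"
proof (induction w)
  case (FWord xs)
  then show ?case by (induction xs) (auto simp: act_add_right)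
qed

lemma act_word_scale:
  "set (letters w) \<subseteq> vectors \<LL> \<Longrightarrow> act_word w (scaleM c m) = scaleM c (act_word w m)"
proof (induction w)
  case (FWord xs)
  then show ?case by (induction xs) (auto simp: act_scale_right)
qed

lemma act_word_sum:
  assumes "set (letters w) \<subseteq> vectors \<LL>"
  shows "act_word w (sum g I) = (\<Sum>i\<in>I. act_word w (g i))"
proof -
  have "act_word w 0 = 0"
    using act_word_add[OF assms, of 0 0] by simp
  then show ?thesis
    using act_word_add[OF assms] by (induction I rule: infinite_finite_induct) simp_all
qed

lemma act_tensor_add: "act_tensor (f + g) m = act_tensor f m + act_tensor g m"
  unfolding act_tensor_def
  by (rule Poly_Mapping.setsum_keys_plus_distrib) (simp_all add: M.scale_left_distrib)

lemma act_tensor_zero [simp]: "act_tensor 0 m = 0"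
  by (simp add: act_tensor_def)

lemma act_tensor_uminus: "act_tensor (- f) m = - act_tensor f m"
  using act_tensor_add[of f "- f" m] by (simp add: minus_unique)

lemma act_tensor_diff: "act_tensor (f - g) m = act_tensor f m - act_tensor g m"
  using act_tensor_add[of f "- g" m] by (simp add: act_tensor_uminus)

lemma act_tensor_sum: "act_tensor (sum f I) m = (\<Sum>i\<in>I. act_tensor (f i) m)"
  by (induction I rule: infinite_finite_induct) (simp_all add: act_tensor_add)

lemma act_tensor_single: "act_tensor (Poly_Mapping.single w c) m = scaleM c (act_word w m)"
  by (simp add: act_tensor_def)

lemma act_tensor_add_right:
  "f \<in> carrier tensors \<Longrightarrow> act_tensor f (m + n) = act_tensor f m + act_tensor f n"
  by (simp add: act_tensor_def free_algebra_def act_word_add M.scale_right_distrib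
      flip: sum.distrib)

lemma act_tensor_zero_right: "f \<in> carrier tensors \<Longrightarrow> act_tensor f 0 = 0"
  using act_tensor_add_right[of f 0 0] by simp

lemma poly_mapping_as_sum:
  "f = (\<Sum>w\<in>Poly_Mapping.keys f. Poly_Mapping.single w (Poly_Mapping.lookup f w))"
  by (rule poly_mapping_eqI)
    (simp add: lookup_sum lookup_single when_def sum.delta in_keys_iff)

lemma act_tensor_mult:
  assumes f: "f \<in> carrier tensors"
  shows "act_tensor (f * g) m = act_tensor f (act_tensor g m)"
proof -
  have "f * g = (\<Sum>u\<in>Poly_Mapping.keys f. \<Sum>w\<in>Poly_Mapping.keys g.
      Poly_Mapping.single (u + w) (Poly_Mapping.lookup f u * Poly_Mapping.lookup g w))"
    by (subst (1) poly_mapping_as_sum[of f], subst (1) poly_mapping_as_sum[of g])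
      (simp add: sum_product mult_single)
  then have "act_tensor (f * g) m = (\<Sum>u\<in>Poly_Mapping.keys f. \<Sum>w\<in>Poly_Mapping.keys g.
      scaleM (Poly_Mapping.lookup f u * Poly_Mapping.lookup g w) (act_word u (act_word w m)))"
    by (simp add: act_tensor_sum act_tensor_single plus_fword_def)
  also have "\<dots> = (\<Sum>u\<in>Poly_Mapping.keys f. scaleM (Poly_Mapping.lookup f u)
      (act_word u (\<Sum>w\<in>Poly_Mapping.keys g. scaleM (Poly_Mapping.lookup g w) (act_word w m))))"
    using f by (intro sum.cong refl)
      (simp add: act_word_sum act_word_scale free_algebra_def M.scale_sum_right)
  finally show ?thesis by (simp add: act_tensor_def)
qed

lemma act_tensor_enveloping_relations:
  assumes "f \<in> Idl\<^bsub>tensors\<^esub> (enveloping_relations \<LL>)"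
  shows "act_tensor f m = 0"
proof -
  interpret F: ring tensors by (rule ring_free_algebra)
  have F_simps: "monoid.mult tensors = (*)" "ring.add tensors = (+)" "\<zero>\<^bsub>tensors\<^esub> = 0"
    by (simp_all add: free_algebra_def)
  have F_uminus: "\<ominus>\<^bsub>tensors\<^esub> f = - f" if "f \<in> carrier tensors" for f
    using that F.r_neg[OF that] unfolding F_simps by (metis minus_unique)
  let ?K = "{f \<in> carrier tensors. \<forall>m. act_tensor f m = 0}"
  have "ideal ?K tensors"
  proof (rule idealI[OF ring_free_algebra])
    show "subgroup ?K (add_monoid tensors)"
    proof (rule F.add.subgroupI)
      show "?K \<noteq> {}"
        using F.zero_closed F_simps by force
      show "\<ominus>\<^bsub>tensors\<^esub> a \<in> ?K" if "a \<in> ?K" for a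
        using that F.a_inv_closed[of a] by (auto simp: F_uminus act_tensor_uminus)
      show "a \<oplus>\<^bsub>tensors\<^esub> b \<in> ?K" if "a \<in> ?K" "b \<in> ?K" for a b
        using that F.a_closed[of a b] by (auto simp: F_simps act_tensor_add)
    qed auto
    fix a x assume "a \<in> ?K" "x \<in> carrier tensors"
    then show "x \<otimes>\<^bsub>tensors\<^esub> a \<in> ?K" "a \<otimes>\<^bsub>tensors\<^esub> x \<in> ?K"
      using F.m_closed[of x a] F.m_closed[of a x]
      by (auto simp: F_simps act_tensor_mult act_tensor_zero_right)
  qed
  moreover have "enveloping_relations \<LL> \<subseteq> ?K"
  proof (intro subsetI CollectI conjI allI)
    fix f m assume f: "f \<in> enveloping_relations \<LL>"
    show "f \<in> carrier tensors" using f enveloping_relations_carrier by blast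
    show "act_tensor f m = 0"
      using f by (auto simp: enveloping_relations_def act_tensor_diff act_tensor_single
          act_add_left act_scale_left act_bracket)
  qed
  ultimately have "Idl\<^bsub>tensors\<^esub> (enveloping_relations \<LL>) \<subseteq> ?K"
    by (rule F.genideal_minimal)
  then show ?thesis using assms by blast
qed

text \<open>This is the preimage in the tensor algebra of the annihilator of \<open>N\<close> in the enveloping
  algebra.\<close>

definition annihilator :: "'m set \<Rightarrow> ('v fword \<Rightarrow>\<^sub>0 'k) set" where
  "annihilator N = {f \<in> carrier tensors. \<forall>n\<in>N. act_tensor f n = 0}"

text \<open>Every element \<open>r\<close> of the enveloping algebra maps \<open>m\<close> to \<open>c m + n\<close>, where \<open>c\<close> is its constant
  term and \<open>n \<in> N\<close>. So an element \<open>f\<close> that annihilates \<open>N\<close> satisfies \<open>(f r) m = c (f m)\<close>, and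
  the elements \<open>f\<close> for which \<open>f m\<close> lies in a given subspace form a right ideal. The images of
  finitely many generators of the annihilator therefore span the whole image.\<close>

theorem annihilator_orbit_finite_dim:
  assumes noeth: "right_noetherian (universal_enveloping_algebra \<LL>)"
    and N: "M.subspace N" "\<And>x n. x \<in> vectors \<LL> \<Longrightarrow> n \<in> N \<Longrightarrow> act x n \<in> N"
    and m: "\<And>x. x \<in> vectors \<LL> \<Longrightarrow> act x m \<in> N"
  shows "\<exists>B. finite B \<and> (\<lambda>f. act_tensor f m) ` annihilator N \<subseteq> M.span B"
proof -
  interpret F: ring tensors by (rule ring_free_algebra)
  have F_simps: "monoid.mult tensors = (*)" "ring.add tensors = (+)" "\<zero>\<^bsub>tensors\<^esub> = 0"
    by (simp_all add: free_algebra_def)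
  have F_uminus: "\<ominus>\<^bsub>tensors\<^esub> f = - f" if "f \<in> carrier tensors" for f
    using that F.r_neg[OF that] unfolding F_simps by (metis minus_unique)
  let ?J = "Idl\<^bsub>tensors\<^esub> (enveloping_relations \<LL>)"
  have J: "ideal ?J tensors"
    by (rule F.genideal_ideal[OF enveloping_relations_carrier])
  have word_N: "act_word w n \<in> N" if "set (letters w) \<subseteq> vectors \<LL>" "n \<in> N" for w n
    using that
  proof (induction w)
    case (FWord xs)
    then show ?case by (induction xs) (auto simp: N(2))
  qed
  have tensor_N: "act_tensor r n \<in> N" if "r \<in> carrier tensors" "n \<in> N" for r n
    using that unfolding act_tensor_def free_algebra_def
    by (auto intro!: M.subspace_sum M.subspace_scale N(1) word_N)
  have word_m: "act_word w m - scaleM (if w = 0 then 1 else 0) m \<in> N"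
    if "set (letters w) \<subseteq> vectors \<LL>" for w
    using that
  proof (induction w)
    case (FWord xs)
    then show ?case
    proof (induction xs)
      case Nil
      then show ?case using M.subspace_0[OF N(1)] by (simp add: zero_fword_def)
    next
      case (Cons x xs)
      show ?case
      proof (cases "xs = []")
        case True
        then show ?thesis using Cons m by (simp add: zero_fword_def)
      next
        case False
        then show ?thesis using Cons N(2) by (simp add: zero_fword_def)
      qed
    qed
  qed
  \<comment> \<open>\<open>0\<close> is the empty word, so \<open>lookup r 0\<close> is the constant term of \<open>r\<close>\<close>
  have tensor_m: "act_tensor r m - scaleM (Poly_Mapping.lookup r 0) m \<in> N" if "r \<in> carrier tensors" for r
  proof -
    have "Poly_Mapping.lookup r 0 = (\<Sum>w\<in>Poly_Mapping.keys r. Poly_Mapping.lookup r w * (if w = 0 then 1 else 0))"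
      by (simp add: sum.delta in_keys_iff if_distrib cong: if_cong)
    then have "act_tensor r m - scaleM (Poly_Mapping.lookup r 0) m = (\<Sum>w\<in>Poly_Mapping.keys r.
        scaleM (Poly_Mapping.lookup r w) (act_word w m - scaleM (if w = 0 then 1 else 0) m))"
      by (simp only: act_tensor_def M.scale_sum_left M.scale_right_diff_distrib sum_subtractf
          M.scale_scale)
    also have "\<dots> \<in> N"
      using that by (auto simp: free_algebra_def
          intro!: M.subspace_sum M.subspace_scale N(1) word_m)
    finally show ?thesis .
  qed
  have rideal: "right_ideal {f \<in> annihilator N. act_tensor f m \<in> M.span B} tensors" (is "right_ideal ?Q _")
    for B
    unfolding right_ideal_def
  proof (intro conjI ballI)
    show "additive_subgroup ?Q tensors"
      unfolding additive_subgroup_def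
    proof (rule F.add.subgroupI)
      show "?Q \<noteq> {}"
        using F.zero_closed M.span_zero by (force simp: F_simps annihilator_def)
      show "\<ominus>\<^bsub>tensors\<^esub> a \<in> ?Q" if "a \<in> ?Q" for a
        using that F.a_inv_closed[of a]
        by (auto simp: F_uminus act_tensor_uminus annihilator_def M.span_neg)
      show "a \<oplus>\<^bsub>tensors\<^esub> b \<in> ?Q" if "a \<in> ?Q" "b \<in> ?Q" for a b
        using that F.a_closed[of a b]
        by (auto simp: F_simps act_tensor_add annihilator_def M.span_add)
    qed (auto simp: annihilator_def)
  next
    fix f r assume f: "f \<in> ?Q" and r: "r \<in> carrier tensors"
    have f_carrier: "f \<in> carrier tensors" using f by (simp add: annihilator_def)
    have "act_tensor (f * r) m = act_tensor f (act_tensor r m - scaleM (Poly_Mapping.lookup r 0) m)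
        + act_tensor f (scaleM (Poly_Mapping.lookup r 0) m)"
      using f_carrier by (simp add: act_tensor_mult flip: act_tensor_add_right)
    also have "\<dots> = act_tensor f (scaleM (Poly_Mapping.lookup r 0) m)"
      using f tensor_m[OF r] by (simp add: annihilator_def)
    also have "\<dots> = scaleM (Poly_Mapping.lookup r 0) (act_tensor f m)"
      using f_carrier by (simp add: act_tensor_def free_algebra_def act_word_scale
          M.scale_sum_right mult.commute)
    finally have "act_tensor (f * r) m \<in> M.span B"
      using f by (simp add: M.span_scale)
    moreover have "f * r \<in> annihilator N"
      using f r F.m_closed[of f r] tensor_N[OF r]
      by (auto simp: annihilator_def act_tensor_mult F_simps)
    ultimately show "f \<otimes>\<^bsub>tensors\<^esub> r \<in> ?Q" by (simp add: F_simps)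
  qed
  \<comment> \<open>With \<open>B = UNIV\<close> the condition on \<open>act_tensor f m\<close> is void.\<close>
  have "M.span UNIV = UNIV" by (metis M.span_superset top.extremum_uniqueI)
  with rideal[of UNIV] have "right_ideal (annihilator N) tensors" by simp
  moreover have "right_noetherian (tensors Quot ?J)"
    using noeth by (simp add: universal_enveloping_algebra_def)
  ultimately obtain S where S: "finite S" "S \<subseteq> annihilator N"
    "\<And>Q'. right_ideal Q' tensors \<Longrightarrow> ?J \<subseteq> Q' \<Longrightarrow> S \<subseteq> Q' \<Longrightarrow> annihilator N \<subseteq> Q'"
    using right_noetherian_quotient[OF ring_free_algebra J] by metis
  let ?B = "(\<lambda>f. act_tensor f m) ` S"
  have "annihilator N \<subseteq> {f \<in> annihilator N. act_tensor f m \<in> M.span ?B}"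
  proof (rule S(3)[OF rideal])
    show "?J \<subseteq> {f \<in> annihilator N. act_tensor f m \<in> M.span ?B}"
      using ideal.Icarr[OF J] by (auto simp: act_tensor_enveloping_relations annihilator_def M.span_zero)
    show "S \<subseteq> {f \<in> annihilator N. act_tensor f m \<in> M.span ?B}"
      using S(2) by (auto intro: M.span_base)
  qed
  then show ?thesis
    using S(1) by (intro exI[of _ ?B]) blast
qed

end

section \<open>Derivations of a domain and of its field of fractions\<close>

text \<open>The ambient field for all derivations is the field of fractions, with \<open>scalar\<close> the embedding
  of the ground field.\<close>

locale k_domain = k_algebra scale
  for scale :: "'k::field_char_0 \<Rightarrow> 'a::idom \<Rightarrow> 'a"
begin

definition scalar :: "'k \<Rightarrow> 'a fract" where
  "scalar c = to_fract (scale c 1)"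

lemma to_fract_scale: "to_fract (scale c a) = scalar c * to_fract a"
  using scale_mult_left[of c 1 a] by (simp add: scalar_def flip: to_fract_mult)

lemma scalar_simps [simp]:
  "scalar 0 = 0" "scalar 1 = 1" "scalar (c + d) = scalar c + scalar d"
  "scalar (c - d) = scalar c - scalar d" "scalar (- c) = - scalar c"
  "scalar (c * d) = scalar c * scalar d"
  "scalar c = 0 \<longleftrightarrow> c = 0"
proof -
  show "scalar (c * d) = scalar c * scalar d"
    using to_fract_scale[of c "scale d 1"] by (simp add: scalar_def)
  show "scalar c = 0 \<longleftrightarrow> c = 0" by (simp add: scalar_def)
qed (simp_all add: scalar_def scale_left_distrib scale_left_diff_distrib)

lemma of_nat_fract_neq_0: "of_nat (Suc n) \<noteq> (0 :: 'a fract)"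
proof -
  have "of_nat m = scalar (of_nat m)" for m
    by (induction m) simp_all
  then show ?thesis by (metis of_nat_neq_0 scalar_simps(7))
qed

abbreviation constants :: "'a fract set" where
  "constants \<equiv> range scalar"

lemma unital_subring_constants: "unital_subring constants"
proof -
  have "1 = scalar 1" by simp
  moreover have "scalar c - scalar d = scalar (c - d)" "scalar c * scalar d = scalar (c * d)" for c d
    by simp_all
  ultimately show ?thesis unfolding unital_subring_def by blast
qed

lemma unital_subring_range_to_fract: "unital_subring (range (to_fract :: 'a \<Rightarrow> 'a fract))"
proof -
  have "1 = to_fract (1::'a)" by simp
  moreover have "to_fract a - to_fract b = to_fract (a - b)" "to_fract a * to_fract b = to_fract (a * b)"
    for a b :: 'a
    by simp_all
  ultimately show ?thesis unfolding unital_subring_def by blast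
qed

lemma fract_as_quotient:
  fixes z :: "'a fract"
  shows "\<exists>a b. b \<noteq> 0 \<and> z = to_fract a / to_fract b"
  by (cases z) (auto simp: to_fract_def)

lemma derivations_iff:
  "v \<in> derivations scale \<longleftrightarrow> (\<forall>a b. v (a + b) = v a + v b) \<and>
     (\<forall>c a. v (scale c a) = scale c (v a)) \<and> (\<forall>a b. v (a * b) = a * v b + v a * b)"
  by (auto simp: derivations_def linear_iff_pointwise)

lemma differential_basis_fract: "differential_basis (range to_fract) (UNIV :: 'a fract set) {}"
  by (rule differential_basis_fractions[OF unital_subring_range_to_fract])
    (use fract_as_quotient in fastforce)

text \<open>If \<open>v\<close> is a derivation then exactly one such \<open>d\<close> exists; for other functions the value is
  arbitrary.\<close>

definition extend :: "('a \<Rightarrow> 'a) \<Rightarrow> 'a fract \<Rightarrow> 'a fract" where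
  "extend v = (SOME d. derivation_on UNIV d \<and> (\<forall>a. d (to_fract a) = to_fract (v a)))"

lemma extend_exists:
  assumes v: "v \<in> derivations scale"
  shows "derivation_on UNIV (extend v)" "extend v (to_fract a) = to_fract (v a)"
proof -
  define D where "D z = to_fract (v (inv_into UNIV to_fract z))" for z :: "'a fract"
  have "inj (to_fract :: 'a \<Rightarrow> 'a fract)" by (simp add: inj_def)
  then have D: "D (to_fract a) = to_fract (v a)" for a by (simp add: D_def)
  have "D (to_fract a + to_fract b) = D (to_fract a) + D (to_fract b) \<and>
      D (to_fract a * to_fract b) = to_fract a * D (to_fract b) + D (to_fract a) * to_fract b" for a b
    using v D[of "a + b"] D[of "a * b"] by (simp add: D derivations_iff)
  then have "derivation_on (range to_fract) D"
    unfolding derivation_on_def by blast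
  from differential_basisD(4)[OF differential_basis_fract this]
  obtain d where "derivation_on UNIV d" "\<forall>z\<in>range to_fract. d z = D z" by blast
  then have "derivation_on UNIV d \<and> (\<forall>a. d (to_fract a) = to_fract (v a))"
    by (simp add: D)
  from someI[where P = "\<lambda>d. derivation_on UNIV d \<and> (\<forall>a. d (to_fract a) = to_fract (v a))", OF this]
  show "derivation_on UNIV (extend v)" "extend v (to_fract a) = to_fract (v a)"
    unfolding extend_def by blast+
qed

lemma extend_unique:
  assumes "v \<in> derivations scale" "derivation_on UNIV d" "\<And>a. d (to_fract a) = to_fract (v a)"
  shows "extend v z = d z"
  by (rule differential_basisD(5)[OF differential_basis_fract])
    (use assms extend_exists[OF assms(1)] in auto)

text \<open>A linear relation between these vectors is a polynomial over the constants that vanishes at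
  \<open>w\<close>. The scalar multiplication is that of the module on which the Lie algebra will act.\<close>

lemma powers_not_in_finite_span:
  assumes w: "\<not> algebraic_over constants w" and "c \<noteq> 0" and "finite B"
  shows "\<not> range (\<lambda>n. (0, c * w ^ n)) \<subseteq>
    module.span (\<lambda>c m. (c * fst m, scalar c * snd m)) (B :: ('k \<times> 'a fract) set)"
proof
  let ?scale = "\<lambda>c m :: 'k \<times> 'a fract. (c * fst m, scalar c * snd m)"
  let ?v = "\<lambda>n. (0 :: 'k, c * w ^ n)"
  interpret M: vector_space ?scale
    by unfold_locales (auto simp: algebra_simps)
  assume span: "range ?v \<subseteq> M.span B"
  have poly_0: "q = 0" if "poly q w = 0" "q \<in> polys_over constants" for q
    using that w unfolding algebraic_over_def by blast
  have inj: "inj ?v"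
  proof (rule injI)
    fix m n assume "?v m = ?v n"
    then have "poly (Polynomial.monom 1 m - Polynomial.monom 1 n) w = 0"
      using \<open>c \<noteq> 0\<close> by (simp add: poly_monom)
    moreover have "Polynomial.monom 1 m - Polynomial.monom 1 n \<in> polys_over constants"
      by (intro polys_over_closed unital_subringD unital_subring_constants)
    ultimately have "Polynomial.monom (1 :: 'a fract) m = Polynomial.monom 1 n"
      using poly_0 by fastforce
    then show "m = n"
      by (metis degree_monom_eq one_neq_zero)
  qed
  have "M.independent (range ?v)"
    unfolding M.independent_explicit_finite_subsets
  proof (intro allI impI ballI)
    fix V u m assume V: "V \<subseteq> range ?v" "finite V" "(\<Sum>m\<in>V. ?scale (u m) m) = 0" and m: "m \<in> V"
    obtain I where I: "finite I" "V = ?v ` I"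
      using V by (meson finite_subset_image)
    let ?q = "\<Sum>i\<in>I. Polynomial.monom (scalar (u (?v i))) i"
    have coeff: "poly.coeff ?q j = (if j \<in> I then scalar (u (?v j)) else 0)" for j
      using I(1) by (simp add: coeff_sum)
    have "snd (\<Sum>m\<in>V. ?scale (u m) m) = (\<Sum>i\<in>I. scalar (u (?v i)) * (c * w ^ i))"
      unfolding I(2) by (subst sum.reindex[OF inj_on_subset[OF inj subset_UNIV]]) (simp add: snd_sum)
    also have "\<dots> = c * poly ?q w"
      by (simp add: poly_sum poly_monom sum_distrib_left mult_ac)
    finally have "poly ?q w = 0" using V(3) \<open>c \<noteq> 0\<close> by simp
    moreover have "?q \<in> polys_over constants"
      using unital_subringD(1)[OF unital_subring_constants] unfolding polys_over_def by (simp add: coeff)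
    ultimately have "?q = 0" by (rule poly_0)
    moreover obtain i where i: "i \<in> I" "m = ?v i" using m I by blast
    ultimately show "u m = 0" using coeff[of i] by simp
  qed
  then have "finite (range ?v)"
    using M.independent_span_bound[OF \<open>finite B\<close> _ span] by blast
  then show False using finite_imageD[OF _ inj] by blast
qed

end

section \<open>The extension defined by the divergence\<close>

locale divergence_extension = k_domain scale + partial_derivations constants T \<delta>
  for scale :: "'k::field_char_0 \<Rightarrow> 'a::idom \<Rightarrow> 'a" and T \<delta>
begin

lemma vector_field_iff:
  "vector_field V \<longleftrightarrow> derivation_on UNIV V \<and> (\<forall>c. V (scalar c) = 0)"
  by (auto simp: vector_field_def)

lemma vector_field_scalar: "vector_field V \<Longrightarrow> V (scalar c * z) = scalar c * V z"
  using vector_fieldD(2,6) by (simp add: vector_fieldD(2) vector_fieldD(6))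

lemma vector_field_extend:
  assumes v: "v \<in> derivations scale"
  shows "vector_field (extend v)"
proof -
  have "v (1 * 1) = 1 * v 1 + v 1 * 1" using v unfolding derivations_iff by blast
  then have "v 1 = 0" by (metis add.right_neutral add_left_imp_eq mult_1 mult_1_right)
  then have "v (scale c 1) = 0" for c
    using v unfolding derivations_iff by simp
  then have "extend v (scalar c) = 0" for c
    using extend_exists(2)[OF v, of "scale c 1"] by (simp add: scalar_def)
  then show ?thesis
    using extend_exists(1)[OF v] by (simp add: vector_field_iff)
qed

lemma extend_eq:
  assumes "v \<in> derivations scale" "vector_field V" "\<And>a. V (to_fract a) = to_fract (v a)"
  shows "extend v = V"
  using extend_unique[OF assms(1) _ assms(3)] assms(2) unfolding vector_field_iff by blast

definition scaleM :: "'k \<Rightarrow> 'k \<times> 'a fract \<Rightarrow> 'k \<times> 'a fract" where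
  "scaleM c m = (c * fst m, scalar c * snd m)"

text \<open>The extension of the trivial module by the field of fractions that corresponds to the
  divergence cocycle.\<close>

definition act :: "('a \<Rightarrow> 'a) \<Rightarrow> 'k \<times> 'a fract \<Rightarrow> 'k \<times> 'a fract" where
  "act v m = (0, extend v (snd m) + scalar (fst m) * divergence (extend v))"

lemma lie_module_act: "lie_module (Der scale) scaleM act"
proof -
  interpret L: lie_algebra "Der scale" by (rule lie_algebra_Der)
  interpret M: vector_space scaleM
    by unfold_locales (auto simp: scaleM_def algebra_simps)
  have L_simps: "vectors (Der scale) = derivations scale"
    "smul (Der scale) = (\<lambda>c v a. scale c (v a))" "bracket (Der scale) = (\<lambda>v w a. v (w a) - w (v a))"
    by (simp_all add: Der_def)
  note L_subspace = L.subspace_vectors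
  show ?thesis
  proof unfold_locales
    fix v m n assume v: "v \<in> vectors (Der scale)"
    note V = vector_field_extend[OF v[unfolded L_simps]]
    show "act v (m + n) = act v m + act v n"
      by (simp add: act_def vector_fieldD(1)[OF V] algebra_simps)
    show "act v (scaleM c m) = scaleM c (act v m)" for c
      by (simp add: act_def scaleM_def vector_field_scalar[OF V] distrib_left mult.assoc)
    show "act (smul (Der scale) c v) m = scaleM c (act v m)" for c
    proof -
      have "smul (Der scale) c v \<in> derivations scale"
        using L.subspace_scale[OF L_subspace v] by (simp add: L_simps)
      then have "extend (smul (Der scale) c v) = (\<lambda>z. scalar c * extend v z)"
      proof (rule extend_eq)
        show "vector_field (\<lambda>z. scalar c * extend v z)"
          unfolding vector_field_iff derivation_on_def
          using V vector_field_iff by (simp add: vector_fieldD(1,2)[OF V] algebra_simps)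
      qed (use v in \<open>simp add: L_simps extend_exists to_fract_scale\<close>)
      moreover have "extend v (scalar c) = 0" using V vector_field_iff by blast
      ultimately show ?thesis
        by (simp add: act_def scaleM_def divergence_mult[OF V] distrib_left)
    qed
    fix w assume w: "w \<in> vectors (Der scale)"
    note W = vector_field_extend[OF w[unfolded L_simps]]
    show "act (v + w) m = act v m + act w m"
    proof -
      have "v + w \<in> derivations scale"
        using L.subspace_add[OF L_subspace v w] by (simp add: L_simps)
      then have "extend (v + w) = (\<lambda>z. extend v z + extend w z)"
      proof (rule extend_eq)
        show "vector_field (\<lambda>z. extend v z + extend w z)"
          unfolding vector_field_iff derivation_on_def
          using V W vector_field_iff
          by (simp add: vector_fieldD(1,2)[OF V] vector_fieldD(1,2)[OF W] algebra_simps)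
      qed (use v w in \<open>simp add: L_simps extend_exists\<close>)
      then show ?thesis
        by (simp add: act_def divergence_add algebra_simps)
    qed
    show "act (bracket (Der scale) v w) m = act v (act w m) - act w (act v m)"
    proof -
      have "bracket (Der scale) v w \<in> derivations scale"
        using L.bracket_closed[OF v w] by (simp add: L_simps)
      then have "extend (bracket (Der scale) v w)
          = (\<lambda>z. extend v (extend w z) - extend w (extend v z))"
        by (rule extend_eq[OF _ vector_field_commutator[OF V W]])
          (use v w in \<open>simp add: L_simps extend_exists\<close>)
      then show ?thesis
        by (simp add: act_def divergence_commutator[OF V W] vector_fieldD(1)[OF V] vector_fieldD(1)[OF W]
            vector_field_scalar[OF V] vector_field_scalar[OF W] algebra_simps)
    qed
  qed
qed

sublocale M: lie_module "Der scale" scaleM act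
  by (rule lie_module_act)

lemma multiple_of_derivation:
  assumes v: "v \<in> derivations scale"
  shows "(\<lambda>a. f * v a) \<in> derivations scale"
    and "extend (\<lambda>a. f * v a) z = to_fract f * extend v z"
proof -
  show fv: "(\<lambda>a. f * v a) \<in> derivations scale"
    using v by (simp add: derivations_iff algebra_simps scale_mult_right)
  note V = vector_field_extend[OF v]
  have "vector_field (\<lambda>z. to_fract f * extend v z)"
    unfolding vector_field_iff derivation_on_def
    using V vector_field_iff by (simp add: vector_fieldD(1,2)[OF V] algebra_simps)
  then have "extend (\<lambda>a. f * v a) = (\<lambda>z. to_fract f * extend v z)"
    by (rule extend_eq[OF fv]) (simp add: extend_exists[OF v])
  then show "extend (\<lambda>a. f * v a) z = to_fract f * extend v z" by simp
qed

text \<open>Write \<open>E\<close> for the extended derivation. On functions, \<open>(f E)(g E) = f g E\<^sup>2 + f E(g) E\<close>, while on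
  \<open>(1, 0)\<close> the product of \<open>f E\<close> and \<open>g E\<close> gives \<open>f E(g div E + E g)\<close>. The coefficients of \<open>u\<close> are chosen so
  that both \<open>f g\<close> and \<open>f E(g)\<close> sum to zero; then all that survives is the sum of the \<open>f E(E g)\<close>,
  which is \<open>h E(E(w\<^sup>2)) - 2 h w E(E w) = 2 h (E w)\<^sup>2\<close>.\<close>

lemma annihilator_element:
  fixes h w :: 'a
  assumes v: "v \<in> derivations scale"
  defines "u \<equiv> monomial 1 [\<lambda>a. h * w\<^sup>2 * v a, v] - monomial 2 [\<lambda>a. h * w * v a, \<lambda>a. w * v a]
    + monomial 1 [\<lambda>a. h * v a, \<lambda>a. w\<^sup>2 * v a]"
  shows "u \<in> M.annihilator (range (Pair 0))"
    and "M.act_tensor u (1, 0) = (0, 2 * to_fract h * (to_fract (v w))\<^sup>2)"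
proof -
  let ?E = "extend v" and ?h = "to_fract h" and ?w = "to_fract w"
  note E = vector_field_extend[OF v]
  have Ew: "?E ?w = to_fract (v w)" using extend_exists[OF v] by simp
  have u_carrier: "u \<in> carrier M.tensors"
  proof -
    note v_mult = multiple_of_derivation(1)[OF v]
    have "monomial c [x, y] \<in> carrier M.tensors" if "x \<in> derivations scale" "y \<in> derivations scale"
      for c x y
      using that by (simp add: free_algebra_def Der_def)
    moreover have "p - q \<in> carrier M.tensors" "p + q \<in> carrier M.tensors"
      if "p \<in> carrier M.tensors" "q \<in> carrier M.tensors" for p q
      using that Poly_Mapping.keys_diff[of p q] Poly_Mapping.keys_add[of p q]
      by (auto simp: free_algebra_def)
    ultimately show ?thesis using v v_mult unfolding u_def by simp
  qed
  have act_mult: "act (\<lambda>a. f * v a) (c, b)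
      = (0, to_fract f * ?E b + scalar c * (to_fract f * divergence ?E + ?E (to_fract f)))" for f c b
  proof -
    have "extend (\<lambda>a. f * v a) = (\<lambda>z. to_fract f * ?E z)"
      by (rule ext) (rule multiple_of_derivation(2)[OF v])
    then show ?thesis by (simp add: act_def divergence_mult[OF E])
  qed
  have act_v: "act v (c, b) = (0, ?E b + scalar c * divergence ?E)" for c b
    by (simp add: act_def)
  have numeral: "scalar 2 = 2" using scalar_simps(3)[of 1 1] by simp
  have u: "M.act_tensor u m = act (\<lambda>a. h * w\<^sup>2 * v a) (act v m)
      - scaleM 2 (act (\<lambda>a. h * w * v a) (act (\<lambda>a. w * v a) m))
      + act (\<lambda>a. h * v a) (act (\<lambda>a. w\<^sup>2 * v a) m)" for m
    by (simp add: u_def M.act_tensor_add M.act_tensor_diff M.act_tensor_single)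
  note E_simps = vector_fieldD(1,2)[OF E] power2_eq_square
  have "M.act_tensor u (0, b) = 0" for b
    unfolding u act_mult act_v
    by (simp add: scaleM_def E_simps numeral zero_prod_def algebra_simps)
  then show "u \<in> M.annihilator (range (Pair 0))"
    unfolding M.annihilator_def using u_carrier by auto
  have "?E 2 = 0" using vector_fieldD(1)[OF E, of 1 1] vector_fieldD(4)[OF E] by simp
  then show "M.act_tensor u (1, 0) = (0, 2 * to_fract h * (to_fract (v w))\<^sup>2)"
    unfolding u act_mult act_v
    by (simp add: scaleM_def E_simps numeral vector_fieldD(3)[OF E] algebra_simps flip: Ew)
qed

theorem not_right_noetherian_if_transcendental_moves:
  assumes v: "v \<in> derivations scale" and "v w \<noteq> 0"
    and w: "\<not> algebraic_over constants (to_fract w)"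
  shows "\<not> right_noetherian (universal_enveloping_algebra (Der scale))"
proof
  assume noeth: "right_noetherian (universal_enveloping_algebra (Der scale))"
  have "\<exists>B. finite B \<and>
    (\<lambda>u. M.act_tensor u (1, 0)) ` M.annihilator (range (Pair 0)) \<subseteq> M.M.span B"
  proof (rule M.annihilator_orbit_finite_dim[OF noeth])
    show "M.M.subspace (range (Pair 0))"
      unfolding M.M.subspace_def by (auto simp: zero_prod_def scaleM_def)
    show "act x n \<in> range (Pair 0)" "act x (1, 0) \<in> range (Pair 0)" for x n
      by (simp_all add: act_def)
  qed
  then obtain B where B: "finite B"
    "(\<lambda>u. M.act_tensor u (1, 0)) ` M.annihilator (range (Pair 0)) \<subseteq> M.M.span B"
    by (elim exE conjE)
  let ?c = "2 * (to_fract (v w))\<^sup>2"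
  have span: "(0, ?c * to_fract w ^ n) \<in> M.M.span B" for n
  proof -
    have "to_fract (w ^ n) = to_fract w ^ n"
      by (induction n) simp_all
    then have "?c * to_fract w ^ n = 2 * to_fract (w ^ n) * (to_fract (v w))\<^sup>2"
      by (simp only: mult_ac)
    then show ?thesis
      using subsetD[OF B(2) imageI[OF annihilator_element(1)[OF v, of "w ^ n" w]]]
      by (simp only: annihilator_element(2)[OF v])
  qed
  have "?c \<noteq> 0"
    using \<open>v w \<noteq> 0\<close> of_nat_fract_neq_0[of 1] by simp
  then show False
    using powers_not_in_finite_span[OF w _ B(1), of ?c] span
    unfolding scaleM_def[abs_def, symmetric] by blast
qed

text \<open>The elements that \<open>s V\<close> maps into the ring form a subalgebra, so it suffices that \<open>s\<close> clears
  the denominators of the values of \<open>V\<close> at finitely many generators.\<close>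

lemma derivation_clearing_denominators:
  assumes fg: finitely_generated_algebra and V: "vector_field V"
  shows "\<exists>v\<in>derivations scale. \<exists>s. s \<noteq> 0 \<and> (\<forall>a. to_fract (v a) = to_fract s * V (to_fract a))"
proof -
  obtain G where G: "finite G" "subalgebra hull G = UNIV"
    using fg unfolding finitely_generated_algebra_def by blast
  have "\<exists>s. s \<noteq> 0 \<and> (\<forall>g\<in>G. to_fract s * V (to_fract g) \<in> range to_fract)"
    using \<open>finite G\<close>
  proof (induction G)
    case empty
    show ?case by (rule exI[of _ 1]) simp
  next
    case (insert g G)
    then obtain s where s: "s \<noteq> 0" "\<forall>g\<in>G. to_fract s * V (to_fract g) \<in> range to_fract"
      by blast
    obtain p q where pq: "q \<noteq> 0" "V (to_fract g) = to_fract p / to_fract q"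
      using fract_as_quotient by blast
    have "to_fract (s * q) * V (to_fract g) = to_fract (s * p)"
      using pq by simp
    then have g: "to_fract (s * q) * V (to_fract g) \<in> range to_fract" by (rule range_eqI)
    have G: "to_fract (s * q) * V (to_fract x) \<in> range to_fract" if x: "x \<in> G" for x
    proof -
      obtain a where "to_fract s * V (to_fract x) = to_fract a"
        using bspec[OF s(2) x] by (rule rangeE)
      then have "to_fract (s * q) * V (to_fract x) = to_fract (a * q)"
        by (simp add: mult.assoc mult.left_commute mult.commute[of _ "to_fract q"])
      then show ?thesis by (rule range_eqI)
    qed
    have "\<forall>x\<in>insert g G. to_fract (s * q) * V (to_fract x) \<in> range to_fract"
    proof
      fix x assume "x \<in> insert g G"
      then show "to_fract (s * q) * V (to_fract x) \<in> range to_fract"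
        by (elim insertE) (simp_all only: g G)
    qed
    moreover have "s * q \<noteq> 0" using s(1) pq(1) by simp
    ultimately show ?case by blast
  qed
  then obtain s where s: "s \<noteq> 0" "\<And>g. g \<in> G \<Longrightarrow> to_fract s * V (to_fract g) \<in> range to_fract"
    by blast
  let ?A = "{a. to_fract s * V (to_fract a) \<in> range to_fract}"
  note V_simps = vector_fieldD[OF V] vector_field_scalar[OF V]
  have "subalgebra ?A"
    unfolding subalgebra_def subspace_def
  proof (intro conjI ballI allI)
    have "to_fract s * V (to_fract 0) = to_fract 0" "to_fract s * V (to_fract 1) = to_fract 0"
      using V_simps(3,4) by simp_all
    then show "0 \<in> ?A" "1 \<in> ?A" by blast+
    fix a assume a: "a \<in> ?A"
    then obtain a' where a': "to_fract s * V (to_fract a) = to_fract a'" by auto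
    show "scale c a \<in> ?A" for c
    proof -
      have "to_fract s * V (to_fract (scale c a)) = to_fract (scale c a')"
        by (simp add: to_fract_scale V_simps mult.left_commute flip: a')
      then show ?thesis by blast
    qed
    fix b assume b: "b \<in> ?A"
    then obtain b' where b': "to_fract s * V (to_fract b) = to_fract b'" by auto
    have "to_fract s * V (to_fract (a + b)) = to_fract (a' + b')"
      by (simp add: V_simps distrib_left flip: a' b')
    then show "a + b \<in> ?A" by blast
    have "to_fract s * V (to_fract (a * b)) = to_fract (a * b' + a' * b)"
      by (simp add: V_simps algebra_simps flip: a' b')
    then show "a * b \<in> ?A" by blast
  qed
  moreover have "G \<subseteq> ?A" using s(2) by blast
  ultimately have "subalgebra hull G \<subseteq> ?A" by (rule hull_minimal[rotated])
  then have "\<forall>a. \<exists>b. to_fract b = to_fract s * V (to_fract a)"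
    unfolding G(2) by (auto simp: image_iff eq_commute)
  then obtain v where v: "\<And>a. to_fract (v a) = to_fract s * V (to_fract a)" by metis
  have "v \<in> derivations scale"
    unfolding derivations_iff
  proof (intro conjI allI)
    fix a b c
    have "to_fract (v (a + b)) = to_fract (v a + v b)"
      by (simp add: v V_simps distrib_left)
    then show "v (a + b) = v a + v b" by (simp only: to_fract_eq_iff)
    have "to_fract (v (scale c a)) = to_fract (scale c (v a))"
      by (simp add: v V_simps to_fract_scale mult.left_commute)
    then show "v (scale c a) = scale c (v a)" by (simp only: to_fract_eq_iff)
    have "to_fract (v (a * b)) = to_fract (a * v b + v a * b)"
      by (simp add: v V_simps algebra_simps)
    then show "v (a * b) = a * v b + v a * b" by (simp only: to_fract_eq_iff)
  qed
  then show ?thesis using s(1) v by blast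
qed

end

section \<open>Coordinate rings of affine curves\<close>

context k_domain
begin

text \<open>A polynomial of minimal degree that vanishes at \<open>a\<close> has a nonzero constant term, since
  otherwise a factor \<open>a\<close> could be cancelled. The equation then exhibits this constant as a multiple
  of \<open>a\<close>.\<close>

lemma algebraic_imp_unit:
  assumes a: "algebraic_over constants (to_fract a)" and "a \<noteq> 0"
  shows "a dvd 1"
proof -
  obtain p where p: "p \<in> polys_over constants" "p \<noteq> 0" "poly p (to_fract a) = 0"
    and min: "\<forall>q\<in>polys_over constants. poly q (to_fract a) = 0 \<longrightarrow> q \<noteq> 0 \<longrightarrow>
      Polynomial.degree p \<le> Polynomial.degree q"
    using algebraic_over_minimal[OF a] by blast
  obtain c' q where pq: "p = pCons c' q" by (cases p)
  then obtain c where c: "c' = scalar c" and q: "q \<in> polys_over constants"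
    using p(1) by auto
  have eq: "scalar c + to_fract a * poly q (to_fract a) = 0"
    using p(3) by (simp add: pq c)
  have "c \<noteq> 0"
  proof
    assume "c = 0"
    then have "poly q (to_fract a) = 0" "q \<noteq> 0"
      using eq \<open>a \<noteq> 0\<close> p(2) by (auto simp: pq c)
    then have "Polynomial.degree p \<le> Polynomial.degree q" using min q by blast
    then show False using \<open>q \<noteq> 0\<close> by (simp add: pq)
  qed
  have "constants \<subseteq> range to_fract" by (auto simp: scalar_def)
  then have "poly q (to_fract a) \<in> range to_fract"
    by (rule poly_in_subring[OF unital_subring_range_to_fract]) (use q in auto)
  then obtain b where b: "poly q (to_fract a) = to_fract b" by blast
  have "to_fract (a * scale (- inverse c) b) = - scalar (inverse c) * (to_fract a * to_fract b)"
    by (simp add: to_fract_scale)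
  also have "to_fract a * to_fract b = - scalar c"
    using eq b by (simp add: add_eq_0_iff)
  also have "- scalar (inverse c) * - scalar c = to_fract 1"
    using \<open>c \<noteq> 0\<close> scalar_simps(6)[of "inverse c" c] by simp
  finally have "a * scale (- inverse c) b = 1" by (simp only: to_fract_eq_iff)
  then show ?thesis by (metis dvd_triv_left)
qed

end

text \<open>Zero is the only prime ideal, so no chain of primes has positive length.\<close>

lemma krull_dim_field_type:
  assumes field: "\<And>a::'a::idom. a \<noteq> 0 \<Longrightarrow> a dvd 1"
  shows "krull_dim (ring_of_type_algebra :: 'a ring) = 0"
proof -
  have ring_simps: "carrier (ring_of_type_algebra :: 'a ring) = UNIV"
    "monoid.mult (ring_of_type_algebra :: 'a ring) = (*)"
    "\<zero>\<^bsub>(ring_of_type_algebra :: 'a ring)\<^esub> = 0"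
    by (simp_all add: ring_of_type_algebra_def)
  have prime: "P = {0}" if P: "primeideal P (ring_of_type_algebra :: 'a ring)" for P
  proof -
    interpret primeideal P "ring_of_type_algebra :: 'a ring" by fact
    have "a = 0" if "a \<in> P" for a
    proof (rule ccontr)
      assume "a \<noteq> 0"
      then obtain b where b: "1 = a * b" using field unfolding dvd_def by blast
      have "x \<in> P" for x
      proof -
        have "a * (b * x) = x" by (simp only: mult.assoc[symmetric] b[symmetric] mult_1)
        moreover have "a * (b * x) \<in> P"
          using I_r_closed[OF that, of "b * x"] by (simp add: ring_simps)
        ultimately show ?thesis by (simp only:)
      qed
      then have "P = UNIV" by blast
      then show False using I_notcarr by (simp add: ring_simps)
    qed
    then show ?thesis using additive_subgroup.zero_closed[OF additive_subgroup_axioms]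
      by (auto simp: ring_simps)
  qed
  have "krull_dim (ring_of_type_algebra :: 'a ring) \<le> 0"
    unfolding krull_dim_def
  proof (rule Sup_least)
    fix x assume "x \<in> {enat n | n. \<exists>P. (\<forall>i\<le>n. primeideal (P i) (ring_of_type_algebra :: 'a ring)) \<and>
      (\<forall>i<n. P i \<subset> P (Suc i))}"
    then obtain n P where n: "x = enat n" "\<forall>i\<le>n. primeideal (P i) (ring_of_type_algebra :: 'a ring)"
      "\<forall>i<n. P i \<subset> P (Suc i)"
      by blast
    have "n = 0"
    proof (rule ccontr)
      assume "n \<noteq> 0"
      then have "P 0 \<subset> P (Suc 0)" using n(3) by blast
      moreover have "P 0 = {0}" "P (Suc 0) = {0}"
        using n(2) \<open>n \<noteq> 0\<close> by (auto intro!: prime)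
      ultimately show False by simp
    qed
    then show "x \<le> 0" using n(1) by (simp add: zero_enat_def)
  qed
  then show ?thesis by simp
qed

theorem theorem0p2:
  fixes scale :: "'k::field_char_0 \<Rightarrow> 'a::idom \<Rightarrow> 'a"
  assumes "affine_curve scale"
  shows "\<not> noetherian (universal_enveloping_algebra (krichever_novikov scale))"
proof -
  interpret affine_curve scale by fact
  interpret k_domain scale by unfold_locales
  have "\<exists>w. \<not> algebraic_over constants (to_fract w)"
  proof (rule ccontr)
    assume "\<nexists>w. \<not> algebraic_over constants (to_fract w)"
    then have "krull_dim (ring_of_type_algebra :: 'a ring) = 0"
      using algebraic_imp_unit krull_dim_field_type by blast
    then show False using krull_dim_1 by simp
  qed
  then obtain w where w: "\<not> algebraic_over constants (to_fract w)" by blast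
  let ?t = "to_fract w"
  obtain G where G: "finite G" "subalgebra hull G = UNIV"
    using finitely_generated unfolding finitely_generated_algebra_def by blast
  \<comment> \<open>Adjoining \<open>w\<close> before the generators puts it into the differential basis.\<close>
  note S1 = unital_subring_adjoin[OF unital_subring_constants, of ?t]
  obtain B T' where B: "unital_subring B" "to_fract ` G \<subseteq> B"
    and basis_B: "differential_basis (adjoin constants ?t) B T'"
    using differential_basis_finite_extension[OF of_nat_fract_neq_0 S1(1), of "to_fract ` G"] G(1)
    by blast
  have "scalar c \<in> B" for c
    using subset_trans[OF S1(2) differential_basisD(1)[OF basis_B]] by (rule subsetD) (rule rangeI)
  then have "subalgebra {a. to_fract a \<in> B}"
    unfolding subalgebra_def subspace_def
    using unital_subringD[OF B(1)] by (auto simp: to_fract_scale)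
  then have "subalgebra hull G \<subseteq> {a. to_fract a \<in> B}"
    using B(2) by (intro hull_minimal) auto
  then have "to_fract a \<in> B" for a
    unfolding G(2) by blast
  then have "differential_basis B UNIV {}"
    using fract_as_quotient by (intro differential_basis_fractions[OF B(1)]) (metis to_fract_eq_0_iff)
  from differential_basis_trans[OF differential_basis_trans[OF
      differential_basis_adjoin_transcendental[OF unital_subring_constants w] basis_B] this]
  have basis: "differential_basis constants UNIV (insert ?t T')" by simp
  then obtain \<delta> where "partial_derivations constants (insert ?t T') \<delta>"
    by (rule partial_derivations_exist)
  then interpret divergence_extension scale "insert ?t T'" \<delta>
    by (intro divergence_extension.intro k_domain_axioms)
  have t_moves: "\<delta> ?t ?t = 1" by (simp add: partial_dual)
  obtain v s where v: "v \<in> derivations scale" "s \<noteq> 0"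
    "\<And>a. to_fract (v a) = to_fract s * \<delta> ?t (to_fract a)"
    using derivation_clearing_denominators[OF finitely_generated vector_field_partial[of ?t]] by blast
  have "to_fract (v w) = to_fract s" by (simp add: v(3) t_moves)
  then have "v w \<noteq> 0" using v(2) by simp
  from not_right_noetherian_if_transcendental_moves[OF v(1) this w]
  show ?thesis unfolding noetherian_def by blast
qed

end
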